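(* Let $1<q_i<\infty$ for $i=1,2$. Let $0<\alpha<n$ and let $t_1,t_2\in(1,\infty)$ satisfy $\frac1{t_2}=\frac1{t_1}-\frac\alpha n$. Assume that either $$1<p_i<t_i<r_i<\infty\ \text{ for } i=1,2\quad\text{and}\quad \frac{p_1}{p_2}=\frac{q_1}{q_2}=\frac{t_1}{t_2}=\frac{r_1}{r_2},$$ or $$1<p_i\le t_i<r_i=\infty\ \text{ for } i=1,2\quad\text{and}\quad \frac{p_1}{p_2}=\frac{q_1}{q_2}=\frac{t_1}{t_2}.$$ Then there is a constant $C>0$ such that for all $f\in M_{p_1,q_1}^{t_1,r_1}(\mathbb R^n)$, $$\|I_\alpha f\|_{M_{p_2,q_2}^{t_2,r_2}(\mathbb R^n)}\le C\|f\|_{M_{p_1,q_1}^{t_1,r_1}(\mathbb R^n)}.$$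
   Context: Fractional integral operator of order $\alpha$: $I_\alpha f(x)=\int_{\mathbb R^n}\frac{f(y)}{|x-y|^{n-\alpha}}\,dy$, for $f\in L^1_{\mathrm{loc}}(\mathbb R^n)$ as long as the right-hand side makes sense. Lorentz norm: with $d_f(s)=|\{x:|f(x)|>s\}|$ and $f^*(u)=\inf\{s>0:d_f(s)\le u\}$, $\|f\|_{L^{p,q}}=\left(\int_0^\infty(u^{1/p}f^*(u))^q\frac{du}{u}\right)^{1/q}$ for $q<\infty$. For a cube $Q$, $\|f\|_{L^{p,q}(Q)}=\|f\chi_Q\|_{L^{p,q}}$. Dyadic cubes: $Q_{j,m}=\prod_{i=1}^n[2^{-j}m_i,2^{-j}(m_i+1))$, $j\in\mathbb Z$, $m\in\mathbb Z^n$; $\mathcal D$ is the set of all of them. Bourgain-Morrey-Lorentz space: $M_{p,q}^{t,r}(\mathbb R^n)$ is the set of measurable $f$ on $\mathbb R^n$ with $\|f\|_{M_{p,q}^{t,r}(\mathbb R^n)}=\left(\sum_{Q\in\mathcal D}|Q|^{r/t-r/p}\|f\|_{L^{p,q}(Q)}^r\right)^{1/r}<\infty$ (supremum over $Q\in\mathcal D$ of $|Q|^{1/t-1/p}\|f\|_{L^{p,q}(Q)}$ if $r=\infty$). *)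

theory Defs
  imports "HOL-Analysis.Analysis"
begin

text \<open>
  The integral is a Bochner integral, hence \<^term>\<open>0\<close> by convention at points \<open>x\<close> where the
  integrand is not integrable; \<open>fractional_integrable_at\<close> says that the value at \<open>x\<close> is genuine.
\<close>

definition fractional_integrand :: "real \<Rightarrow> (real^'n \<Rightarrow> complex) \<Rightarrow> real^'n \<Rightarrow> real^'n \<Rightarrow> complex" where
  "fractional_integrand \<alpha> f x y =
     f y / complex_of_real (norm (x - y) powr (real CARD('n) - \<alpha>))"

definition fractional_integrable_at :: "real \<Rightarrow> (real^'n \<Rightarrow> complex) \<Rightarrow> real^'n \<Rightarrow> bool" where
  "fractional_integrable_at \<alpha> f x \<longleftrightarrow> integrable lebesgue (fractional_integrand \<alpha> f x)"

definition fractional_integral :: "real \<Rightarrow> (real^'n \<Rightarrow> complex) \<Rightarrow> real^'n \<Rightarrow> complex" where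
  "fractional_integral \<alpha> f x = (LINT y|lebesgue. fractional_integrand \<alpha> f x y)"

text \<open>Real powers of extended nonnegative reals; only used with exponents \<open>a > 0\<close>, for which
  \<open>0\<close> and \<open>\<infinity>\<close> are fixed.\<close>

definition ennreal_powr :: "ennreal \<Rightarrow> real \<Rightarrow> ennreal" where
  "ennreal_powr x a = (if x = \<infinity> then \<infinity> else ennreal (enn2real x powr a))"

definition distribution_function :: "(real^'n \<Rightarrow> complex) \<Rightarrow> real \<Rightarrow> ennreal" where
  "distribution_function f s = emeasure lebesgue {x. norm (f x) > s}"

text \<open>The infimum is taken in \<^typ>\<open>ennreal\<close>, so that \<open>inf \<emptyset> = \<infinity>\<close>.\<close>

definition decreasing_rearrangement :: "(real^'n \<Rightarrow> complex) \<Rightarrow> real \<Rightarrow> ennreal" where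
  "decreasing_rearrangement f u =
     (INF s \<in> {s. s > 0 \<and> distribution_function f s \<le> ennreal u}. ennreal s)"

definition lorentz_norm :: "real \<Rightarrow> real \<Rightarrow> (real^'n \<Rightarrow> complex) \<Rightarrow> ennreal" where
  "lorentz_norm p q f =
     ennreal_powr
       (\<integral>\<^sup>+u\<in>{0<..}. ennreal_powr (ennreal (u powr (1/p)) * decreasing_rearrangement f u) q
                     / ennreal u \<partial>lborel)
       (1/q)"

definition lorentz_norm_on :: "real \<Rightarrow> real \<Rightarrow> (real^'n) set \<Rightarrow> (real^'n \<Rightarrow> complex) \<Rightarrow> ennreal" where
  "lorentz_norm_on p q Q f = lorentz_norm p q (\<lambda>x. indicator Q x *\<^sub>R f x)"

definition dyadic_cube :: "int \<Rightarrow> int^'n \<Rightarrow> (real^'n) set" where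
  "dyadic_cube j m =
     {x. \<forall>i. 2 powi (-j) * of_int (m $ i) \<le> x $ i \<and> x $ i < 2 powi (-j) * (of_int (m $ i) + 1)}"

definition dyadic_cubes :: "(real^'n) set set" where
  "dyadic_cubes = {dyadic_cube j m |j m. True}"

definition bourgain_morrey_lorentz_norm ::
    "real \<Rightarrow> real \<Rightarrow> real \<Rightarrow> ennreal \<Rightarrow> (real^'n \<Rightarrow> complex) \<Rightarrow> ennreal" where
  "bourgain_morrey_lorentz_norm p q t r f =
     (if r = \<infinity>
      then (SUP Q \<in> dyadic_cubes.
              ennreal (measure lebesgue Q powr (1/t - 1/p)) * lorentz_norm_on p q Q f)
      else ennreal_powr
             (\<Sum>\<^sub>\<infinity>Q \<in> dyadic_cubes.
                ennreal (measure lebesgue Q powr (enn2real r/t - enn2real r/p))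
                  * ennreal_powr (lorentz_norm_on p q Q f) (enn2real r))
             (1 / enn2real r))"

definition bourgain_morrey_lorentz_space ::
    "real \<Rightarrow> real \<Rightarrow> real \<Rightarrow> ennreal \<Rightarrow> (real^'n \<Rightarrow> complex) set" where
  "bourgain_morrey_lorentz_space p q t r =
     {f. f \<in> borel_measurable lebesgue \<and> bourgain_morrey_lorentz_norm p q t r f < \<infinity>}"

end

theory Submission
  imports Defs
begin

text \<open>
  The maximal operator is dyadic: \<open>M h x\<close> is the supremum of the averages of \<open>h\<close> over the dyadic cubes
  that contain \<open>x\<close> and over their neighbours of the same generation. It is of weak type (1,1), hence
  \<open>(M h)\<^sup>* u \<le> C sup\<^sub>k 2\<^bsup>- k \<delta>\<^esup> h\<^sup>* (u / 2\<^bsup>k\<^esup>)\<close> with \<open>1/p < \<delta> < 1\<close>, and bounding the supremum by a sum gives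
  boundedness on \<open>L\<^bsup>p,q\<^esup>\<close>. On a cube \<open>Q\<close>, \<open>M h\<close> is the larger of a local part, controlled by the
  Lorentz norms of \<open>h\<close> on the neighbours of \<open>Q\<close>, and of a constant, controlled by the Lorentz norms on the
  neighbours of the ancestors of \<open>Q\<close>; as \<open>t < r\<close>, summing over the ancestors gives a convergent geometric series,
  and \<open>M\<close> is bounded on the Bourgain-Morrey-Lorentz space. Splitting the potential into dyadic
  annuli at an optimal generation gives Hedberg's inequality
  \<open>|I\<^sub>\<alpha> f| \<le> C \<parallel>f\<parallel>\<^bsup>1 - \<theta>\<^esup> (M f)\<^bsup>\<theta>\<^esup>\<close> with \<open>\<theta> = t\<^sub>1 / t\<^sub>2\<close>, and the conditions on the
  parameters say precisely that the target norm of \<open>(M f)\<^bsup>\<theta>\<^esup>\<close> is the \<open>\<theta>\<close>-th power of the source norm of \<open>M f\<close>.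
\<close>

section \<open>Powers of extended nonnegative reals\<close>

text \<open>For \<open>q > p\<close> the Lorentz functional is only a quasi-norm. Pieces are
  therefore never added through a triangle inequality but combined by maxima and suprema: for every
  \<open>q > 0\<close> the q-th power of a supremum is at most the sum of the q-th powers. The
  window \<open>1/p < \<delta> < 1\<close> comes from two competing series:
  \<open>\<delta> < 1\<close> makes the tail averages of \<open>h\<close> summable,
  \<open>\<delta> > 1/p\<close> makes the Lorentz functionals of the dilated rearrangements
  summable. In Hedberg's inequality the maximal function alone cannot control large cubes. There the
  source norm bounds the average at generation \<open>j\<close> by a multiple of
  \<open>2 powr (j n / t1)\<close>, which against the kernel leaves
  \<open>2 powr (j n / t2)\<close>, summable towards large cubes.\<close>

lemma ennreal_powr_top [simp]: "ennreal_powr top a = top"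
  by (simp add: ennreal_powr_def)

lemma ennreal_powr_ennreal [simp]: "0 \<le> x \<Longrightarrow> ennreal_powr (ennreal x) a = ennreal (x powr a)"
  by (simp add: ennreal_powr_def)

lemma ennreal_powr_0 [simp]: "ennreal_powr 0 a = 0"
  by (simp add: ennreal_powr_def)

lemma ennreal_powr_1 [simp]: "ennreal_powr x 1 = x"
  by (cases x) auto

lemma ennreal_powr_eq_0_iff [simp]: "ennreal_powr x a = 0 \<longleftrightarrow> x = 0"
  by (cases x) auto

lemma ennreal_powr_eq_top_iff [simp]: "ennreal_powr x a = top \<longleftrightarrow> x = top"
  by (cases x) auto

lemma ennreal_powr_mono:
  assumes "0 \<le> a" "x \<le> y"
  shows "ennreal_powr x a \<le> ennreal_powr y a"
  using assms by (cases x; cases y) (auto intro!: ennreal_leI powr_mono2 simp: top_unique)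

lemma ennreal_powr_mult:
  assumes "0 < a"
  shows "ennreal_powr (x * y) a = ennreal_powr x a * ennreal_powr y a"
proof -
  have top: "ennreal_powr (z * top) a = ennreal_powr z a * top" for z
    by (cases "z = 0") (auto simp: ennreal_mult_top)
  show ?thesis
  proof (cases "x = top \<or> y = top")
    case True
    then show ?thesis
      using top[of x] top[of y] by (auto simp: mult.commute)
  next
    case False
    then show ?thesis
      by (cases x; cases y) (auto simp: ennreal_mult[symmetric] powr_mult)
  qed
qed

lemma ennreal_powr_powr: "ennreal_powr (ennreal_powr x a) b = ennreal_powr x (a * b)"
  by (cases x) (auto simp: powr_powr)

lemma ennreal_powr_le_iff:
  assumes "0 < a"
  shows "ennreal_powr x a \<le> y \<longleftrightarrow> x \<le> ennreal_powr y (1/a)"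
proof
  assume "ennreal_powr x a \<le> y"
  then have "ennreal_powr (ennreal_powr x a) (1/a) \<le> ennreal_powr y (1/a)"
    using assms by (intro ennreal_powr_mono) auto
  then show "x \<le> ennreal_powr y (1/a)"
    using assms by (simp add: ennreal_powr_powr)
next
  assume "x \<le> ennreal_powr y (1/a)"
  then have "ennreal_powr x a \<le> ennreal_powr (ennreal_powr y (1/a)) a"
    using assms by (intro ennreal_powr_mono) auto
  then show "ennreal_powr x a \<le> y"
    using assms by (simp add: ennreal_powr_powr)
qed

lemma ennreal_powr_SUP_le:
  assumes "0 < a"
  shows "ennreal_powr (SUP i\<in>I. x i) a \<le> (SUP i\<in>I. ennreal_powr (x i) a)"
  unfolding ennreal_powr_le_iff[OF assms]
proof (rule SUP_least)
  fix i assume "i \<in> I"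
  then show "x i \<le> ennreal_powr (SUP i\<in>I. ennreal_powr (x i) a) (1/a)"
    unfolding ennreal_powr_le_iff[OF assms, symmetric] by (rule SUP_upper)
qed

lemma measurable_ennreal_powr [measurable]: "(\<lambda>x. ennreal_powr x a) \<in> borel_measurable borel"
  unfolding ennreal_powr_def by measurable

lemma SUP_le_nn_integral_count_space: "(SUP i\<in>I. x i) \<le> (\<integral>\<^sup>+i. x i \<partial>count_space I)"
  by (auto intro!: SUP_least nn_integral_ge_point)

lemma borel_measurable_antimono:
  fixes \<phi> :: "real \<Rightarrow> ennreal"
  assumes "antimono \<phi>"
  shows "\<phi> \<in> borel_measurable borel"
proof (rule borel_measurableI_greater)
  fix c
  have down: "y < \<phi> b \<Longrightarrow> a \<le> b \<Longrightarrow> y < \<phi> a" for a b y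
    using antimonoD[OF assms, of a b] by (meson less_le_trans)
  have "is_interval {x. c < \<phi> x}"
    unfolding is_interval_1 using down by blast
  then show "{x \<in> space borel. c < \<phi> x} \<in> sets borel"
    by (simp add: real_interval_borel_measurable)
qed

section \<open>Rearrangements and Lorentz functionals\<close>

text \<open>The q-th power of the Lorentz norm, as a functional of the rearrangement alone. Without
  the outer root, suprema turn into sums, and an arbitrary \<open>\<phi>\<close> admits dilated
  rearrangements and step functions.\<close>

definition lorentz_fun :: "real \<Rightarrow> real \<Rightarrow> (real \<Rightarrow> ennreal) \<Rightarrow> ennreal" where
  "lorentz_fun p q \<phi> =
     (\<integral>\<^sup>+u\<in>{0<..}. ennreal_powr (ennreal (u powr (1/p)) * \<phi> u) q / ennreal u \<partial>lborel)"


lemma lorentz_fun_mono: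
  assumes "0 < q" "\<And>u. 0 < u \<Longrightarrow> \<phi> u \<le> \<psi> u"
  shows "lorentz_fun p q \<phi> \<le> lorentz_fun p q \<psi>"
  unfolding lorentz_fun_def using assms
  by (intro nn_integral_mono)
     (auto split: split_indicator intro!: divide_right_mono_ennreal ennreal_powr_mono mult_left_mono)

lemma lorentz_fun_cmult:
  assumes "0 < q" and [measurable]: "\<phi> \<in> borel_measurable borel"
  shows "lorentz_fun p q (\<lambda>u. c * \<phi> u) = ennreal_powr c q * lorentz_fun p q \<phi>"
  unfolding lorentz_fun_def
  by (subst nn_integral_cmult[symmetric])
     (auto intro!: nn_integral_cong split: split_indicator
       simp: ennreal_powr_mult[OF assms(1)] divide_ennreal_def ac_simps)

text \<open>Substitution \<open>v = a u\<close>: the measure \<open>du/u\<close> is invariant, so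
  only the weight \<open>u powr (q/p)\<close> leaves a factor.\<close>

lemma lorentz_fun_dilate:
  assumes "0 < p" "0 < q" "0 < a" and [measurable]: "\<phi> \<in> borel_measurable borel"
  shows "lorentz_fun p q (\<lambda>u. \<phi> (a * u)) = ennreal (a powr (- q/p)) * lorentz_fun p q \<phi>"
proof -
  define G where "G v = ennreal_powr (ennreal (v powr (1/p)) * \<phi> v) q / ennreal v * indicator {0<..} v" for v
  have [measurable]: "G \<in> borel_measurable borel"
    unfolding G_def by measurable
  have *: "ennreal_powr (ennreal (u powr (1/p)) * \<phi> (a * u)) q / ennreal u * indicator {0<..} u
      = ennreal (a powr (1 - q/p)) * G (a * u)" for u
  proof (cases "0 < u")
    case True
    have "u powr (q/p) / u = a powr (1 - q/p) * ((a * u) powr (q/p) / (a * u))"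
      using True assms by (simp add: powr_mult powr_diff)
    then have "ennreal (u powr (q/p) / u) = ennreal (a powr (1 - q/p)) * ennreal ((a * u) powr (q/p) / (a * u))"
      using True assms by (simp add: ennreal_mult[symmetric] del: times_divide_eq_right)
    moreover have "ennreal_powr (ennreal (v powr (1/p)) * y) q / ennreal v = ennreal (v powr (q/p) / v) * ennreal_powr y q"
      if "0 < v" for v y
      using that assms by (simp add: ennreal_powr_mult powr_powr divide_ennreal[symmetric] divide_ennreal_def ac_simps)
    ultimately show ?thesis
      using True assms unfolding G_def by (simp add: ac_simps)
  next
    case False
    then show ?thesis using assms by (simp add: G_def zero_less_mult_iff)
  qed
  have "lorentz_fun p q (\<lambda>u. \<phi> (a * u)) = ennreal (a powr (1 - q/p)) * (\<integral>\<^sup>+u. G (a * u) \<partial>lborel)"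
    unfolding lorentz_fun_def * by (rule nn_integral_cmult) simp
  also have "ennreal (a powr (1 - q/p)) = ennreal (a powr (- q/p)) * ennreal a"
    using assms by (simp add: ennreal_mult[symmetric] powr_diff powr_minus divide_inverse mult.commute)
  also have "\<dots> * (\<integral>\<^sup>+u. G (a * u) \<partial>lborel) = ennreal (a powr (- q/p)) * (\<integral>\<^sup>+u. G u \<partial>lborel)"
    using nn_integral_real_affine[of G a 0] assms by (simp add: mult.assoc)
  finally show ?thesis
    by (simp add: lorentz_fun_def G_def)
qed

text \<open>The supremum is dominated by the sum pointwise, and countability of the index set allows
  the sum and the integral to be exchanged.\<close>

lemma lorentz_fun_SUP:
  assumes "0 < q" "countable I" and [measurable]: "\<And>i. i \<in> I \<Longrightarrow> \<phi> i \<in> borel_measurable borel"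
  shows "lorentz_fun p q (\<lambda>u. SUP i\<in>I. \<phi> i u) \<le> (\<integral>\<^sup>+i. lorentz_fun p q (\<phi> i) \<partial>count_space I)"
proof -
  have "ennreal_powr (ennreal (u powr (1/p)) * (SUP i\<in>I. \<phi> i u)) q / ennreal u * indicator {0<..} u
    \<le> (\<integral>\<^sup>+i. ennreal_powr (ennreal (u powr (1/p)) * \<phi> i u) q / ennreal u * indicator {0<..} u \<partial>count_space I)"
    for u
  proof -
    have "ennreal_powr (ennreal (u powr (1/p)) * (SUP i\<in>I. \<phi> i u)) q
        \<le> (SUP i\<in>I. ennreal_powr (ennreal (u powr (1/p)) * \<phi> i u) q)"
      unfolding SUP_mult_left_ennreal by (rule ennreal_powr_SUP_le) fact
    also have "\<dots> \<le> (\<integral>\<^sup>+i. ennreal_powr (ennreal (u powr (1/p)) * \<phi> i u) q \<partial>count_space I)"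
      by (rule SUP_le_nn_integral_count_space)
    finally have "ennreal_powr (ennreal (u powr (1/p)) * (SUP i\<in>I. \<phi> i u)) q / ennreal u * indicator {0<..} u \<le>
       (\<integral>\<^sup>+i. ennreal_powr (ennreal (u powr (1/p)) * \<phi> i u) q \<partial>count_space I) / ennreal u * indicator {0<..} u"
      by (intro mult_right_mono divide_right_mono_ennreal) auto
    also have "\<dots> = (\<integral>\<^sup>+i. ennreal_powr (ennreal (u powr (1/p)) * \<phi> i u) q / ennreal u * indicator {0<..} u \<partial>count_space I)"
      by (simp add: nn_integral_multc divide_ennreal_def)
    finally show ?thesis .
  qed
  then have "lorentz_fun p q (\<lambda>u. SUP i\<in>I. \<phi> i u) \<le>
    (\<integral>\<^sup>+u. \<integral>\<^sup>+i. ennreal_powr (ennreal (u powr (1/p)) * \<phi> i u) q / ennreal u * indicator {0<..} u \<partial>count_space I \<partial>lborel)"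
    unfolding lorentz_fun_def by (rule nn_integral_mono)
  also have "\<dots> = (\<integral>\<^sup>+i. lorentz_fun p q (\<phi> i) \<partial>count_space I)"
    unfolding lorentz_fun_def by (rule nn_integral_count_space_nn_integral) (use assms(2) in auto)
  finally show ?thesis .
qed

text \<open>This is the embedding of the Lorentz space into its weak type space: a decreasing
  \<open>\<phi>\<close> is at least \<open>\<phi> v\<close> on \<open>[v/2, v]\<close>, and this
  interval alone contributes a fixed multiple of \<open>v powr (q/p)\<close>.\<close>

lemma antimono_le_lorentz_fun:
  assumes "0 < p" "0 < q" "0 < v" "antimono \<phi>"
  shows "\<phi> v \<le> ennreal (2 powr (1/p + 1/q) * v powr (- 1/p)) * ennreal_powr (lorentz_fun p q \<phi>) (1/q)"
proof -
  have "ennreal ((v/2) powr (q/p) / 2) * ennreal_powr (\<phi> v) q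
      = (\<integral>\<^sup>+u. ennreal ((v/2) powr (q/p) / v) * ennreal_powr (\<phi> v) q * indicator {v/2..v} u \<partial>lborel)"
    using assms by (simp add: nn_integral_cmult_indicator)
      (simp add: ennreal_mult[symmetric] ac_simps flip: mult.assoc)
  also have "\<dots> \<le> lorentz_fun p q \<phi>"
    unfolding lorentz_fun_def
  proof (rule nn_integral_mono)
    fix u :: real
    show "ennreal ((v/2) powr (q/p) / v) * ennreal_powr (\<phi> v) q * indicator {v/2..v} u
      \<le> ennreal_powr (ennreal (u powr (1/p)) * \<phi> u) q / ennreal u * indicator {0<..} u"
    proof (cases "u \<in> {v/2..v}")
      case True
      then have u: "0 < u" using assms by auto
      \<comment> \<open>Numerator and denominator are estimated at opposite ends of the interval,
        since the sign of \<open>q/p - 1\<close> is unknown.\<close>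
      have "(v/2) powr (q/p) / v \<le> u powr (q/p) / u"
        using True assms u by (intro frac_le powr_mono2) auto
      then have "ennreal ((v/2) powr (q/p) / v) * ennreal_powr (\<phi> v) q \<le> ennreal (u powr (q/p) / u) * ennreal_powr (\<phi> u) q"
        using True assms by (intro mult_mono ennreal_leI ennreal_powr_mono) (auto dest: antimonoD)
      also have "\<dots> = ennreal_powr (ennreal (u powr (1/p)) * \<phi> u) q / ennreal u"
        using u assms by (simp add: ennreal_powr_mult powr_powr divide_ennreal[symmetric] divide_ennreal_def ac_simps)
      finally show ?thesis using u True by simp
    qed auto
  qed
  finally have "ennreal_powr (ennreal ((v/2) powr (1/p) / 2 powr (1/q)) * \<phi> v) q \<le> lorentz_fun p q \<phi>"
    using assms by (simp add: ennreal_powr_mult powr_divide powr_powr powr_mult)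
  then have *: "ennreal ((v/2) powr (1/p) / 2 powr (1/q)) * \<phi> v \<le> ennreal_powr (lorentz_fun p q \<phi>) (1/q)"
    by (simp add: ennreal_powr_le_iff[OF assms(2)])
  have "2 powr (1/p + 1/q) * v powr (- 1/p) * ((v/2) powr (1/p) / 2 powr (1/q)) = 1"
    using assms by (simp only: powr_add powr_divide powr_minus minus_divide_left[symmetric]) (simp add: field_simps)
  then have "\<phi> v = ennreal (2 powr (1/p + 1/q) * v powr (- 1/p)) * (ennreal ((v/2) powr (1/p) / 2 powr (1/q)) * \<phi> v)"
    using assms by (simp add: mult.assoc[symmetric] ennreal_mult[symmetric])
  also have "\<dots> \<le> ennreal (2 powr (1/p + 1/q) * v powr (- 1/p)) * ennreal_powr (lorentz_fun p q \<phi>) (1/q)"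
    by (intro mult_left_mono *) auto
  finally show ?thesis .
qed

text \<open>Serves the constant part of the maximal function on a cube of volume \<open>v\<close>.
  The factor \<open>p/q * v powr (q/p)\<close> is the integral of \<open>u powr (q/p - 1)\<close>
  over \<open>[0, v]\<close>.\<close>

lemma lorentz_fun_step:
  assumes "0 < p" "0 < q" "0 < v"
  shows "lorentz_fun p q (\<lambda>u. c * indicator {..<v} u) \<le> ennreal (p/q * v powr (q/p)) * ennreal_powr c q"
proof -
  have "((\<lambda>x. x powr (q/p - 1)) has_integral (v powr (q/p) / (q/p))) {0..v}"
    using has_integral_powr_from_0[of "q/p - 1" v] assms by simp
  from nn_integral_has_integral_lebesgue[OF _ this]
  have 1: "(\<integral>\<^sup>+u. ennreal (indicator {0..v} u * u powr (q/p - 1)) \<partial>lborel) = ennreal (p/q * v powr (q/p))"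
    by (simp add: field_simps)
  have "lorentz_fun p q (\<lambda>u. c * indicator {..<v} u)
     \<le> (\<integral>\<^sup>+u. ennreal_powr c q * ennreal (indicator {0..v} u * u powr (q/p - 1)) \<partial>lborel)"
    unfolding lorentz_fun_def
  proof (rule nn_integral_mono)
    fix u :: real
    show "ennreal_powr (ennreal (u powr (1/p)) * (c * indicator {..<v} u)) q / ennreal u * indicator {0<..} u
      \<le> ennreal_powr c q * ennreal (indicator {0..v} u * u powr (q/p - 1))"
    proof (cases "0 < u \<and> u < v")
      case True
      then have "ennreal_powr (ennreal (u powr (1/p)) * c) q / ennreal u = ennreal_powr c q * ennreal (u powr (q/p) / u)"
        using assms by (simp add: ennreal_powr_mult powr_powr divide_ennreal[symmetric] divide_ennreal_def ac_simps)
      then show ?thesis using True by (simp add: powr_diff)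
    qed (auto split: split_indicator)
  qed
  also have "\<dots> = ennreal_powr c q * ennreal (p/q * v powr (q/p))"
    using 1 by (subst nn_integral_cmult) auto
  finally show ?thesis by (simp add: mult.commute)
qed

text \<open>An analogue of \<open>decreasing_rearrangement\<close> for \<open>ennreal\<close>-valued
  functions, because the maximal function may take the value infinity.\<close>

definition rearr :: "'a measure \<Rightarrow> ('a \<Rightarrow> ennreal) \<Rightarrow> real \<Rightarrow> ennreal" where
  "rearr M g u = (INF s\<in>{s. s > 0 \<and> emeasure M {x\<in>space M. ennreal s < g x} \<le> ennreal u}. ennreal s)"

lemma rearr_antimono: "antimono (rearr M g)"
  unfolding rearr_def by (auto intro!: antimonoI INF_superset_mono elim: order_trans intro: ennreal_leI)

lemma measurable_rearr [measurable]: "rearr M g \<in> borel_measurable borel"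
  by (intro borel_measurable_antimono rearr_antimono)

text \<open>The infimum is attained: the sets where \<open>g\<close> exceeds
  \<open>s + 1/(n+1)\<close> increase to the set where it exceeds \<open>s\<close>, and measure is
  continuous along increasing unions. If the rearrangement is infinite, the set is empty.\<close>

lemma emeasure_gt_rearr:
  assumes [measurable]: "g \<in> borel_measurable M"
  shows "emeasure M {x\<in>space M. rearr M g u < g x} \<le> ennreal u"
proof (cases "rearr M g u")
  case (real s)
  have *: "emeasure M {x\<in>space M. ennreal (s + inverse (Suc n)) < g x} \<le> ennreal u" for n
  proof -
    have "rearr M g u < ennreal (s + inverse (Suc n))"
      using real by (simp add: ennreal_less_iff)
    then obtain s' where s': "0 < s'" "emeasure M {x\<in>space M. ennreal s' < g x} \<le> ennreal u"
      "ennreal s' < ennreal (s + inverse (Suc n))"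
      unfolding rearr_def INF_less_iff by auto
    have "emeasure M {x\<in>space M. ennreal (s + inverse (Suc n)) < g x} \<le> emeasure M {x\<in>space M. ennreal s' < g x}"
      using s' by (intro emeasure_mono) (auto intro: less_trans)
    with s' show ?thesis by (meson order_trans)
  qed
  have "{x\<in>space M. rearr M g u < g x} = (\<Union>n. {x\<in>space M. ennreal (s + inverse (Suc n)) < g x})"
  proof safe
    fix x assume "rearr M g u < g x"
    then obtain r where r: "0 \<le> r" "ennreal s < ennreal r" "ennreal r < g x"
      using real by (metis ennreal_cases dense not_less_iff_gr_or_eq top.not_eq_extremum)
    then have "0 < r - s" using real by (simp add: ennreal_less_iff)
    then obtain n where "inverse (Suc n) < r - s" using reals_Archimedean by blast
    then have "ennreal (s + inverse (Suc n)) \<le> ennreal r" by (intro ennreal_leI) auto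
    then show "x \<in> (\<Union>n. {x\<in>space M. ennreal (s + inverse (Suc n)) < g x})" if "x \<in> space M"
      using r that by (blast intro: le_less_trans)
  next
    fix x n assume "ennreal (s + inverse (Suc n)) < g x"
    moreover have "rearr M g u \<le> ennreal (s + inverse (Suc n))"
      unfolding real by (intro ennreal_leI) auto
    ultimately show "rearr M g u < g x" by (rule le_less_trans[rotated])
  qed
  also have "emeasure M \<dots> = (SUP n. emeasure M {x\<in>space M. ennreal (s + inverse (Suc n)) < g x})"
  proof (rule SUP_emeasure_incseq[symmetric])
    show "incseq (\<lambda>n. {x\<in>space M. ennreal (s + inverse (Suc n)) < g x})"
    proof (rule incseq_SucI, safe)
      fix n x assume "ennreal (s + inverse (Suc n)) < g x"
      moreover have "ennreal (s + inverse (Suc (Suc n))) \<le> ennreal (s + inverse (Suc n))"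
        by (intro ennreal_leI) (simp add: field_simps)
      ultimately show "ennreal (s + inverse (Suc (Suc n))) < g x" by (rule le_less_trans[rotated])
    qed
  qed auto
  also have "\<dots> \<le> ennreal u" by (rule SUP_least) (rule *)
  finally show ?thesis .
qed auto

text \<open>Rearrangement and distribution function are adjoint; through this, bounds on
  rearrangements become estimates for the measure of one superlevel set.\<close>

lemma rearr_le_iff:
  assumes [measurable]: "g \<in> borel_measurable M"
  shows "rearr M g u \<le> S \<longleftrightarrow> emeasure M {x\<in>space M. S < g x} \<le> ennreal u"
proof
  assume "rearr M g u \<le> S"
  then have "emeasure M {x\<in>space M. S < g x} \<le> emeasure M {x\<in>space M. rearr M g u < g x}"
    by (intro emeasure_mono) (auto intro: le_less_trans)
  also have "\<dots> \<le> ennreal u" by (rule emeasure_gt_rearr) fact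
  finally show "emeasure M {x\<in>space M. S < g x} \<le> ennreal u" .
next
  assume S: "emeasure M {x\<in>space M. S < g x} \<le> ennreal u"
  show "rearr M g u \<le> S"
  proof (cases S)
    case (real s)
    show ?thesis
    proof (rule ennreal_le_epsilon)
      fix e :: real assume e: "0 < e"
      have "emeasure M {x\<in>space M. ennreal (s + e) < g x} \<le> emeasure M {x\<in>space M. S < g x}"
        using real e by (intro emeasure_mono) (auto elim: le_less_trans[rotated] intro!: ennreal_leI)
      then have "rearr M g u \<le> ennreal (s + e)"
        using S real e unfolding rearr_def by (intro INF_lower) auto
      then show "rearr M g u \<le> S + ennreal e" using real e by simp
    qed
  qed auto
qed

lemma rearr_le_of_level_sets:
  assumes [measurable]: "g \<in> borel_measurable M" "h \<in> borel_measurable M"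
    and "\<And>x. x \<in> space M \<Longrightarrow> S < g x \<Longrightarrow> rearr M h u < h x"
  shows "rearr M g u \<le> S"
  unfolding rearr_le_iff[OF assms(1)]
  using assms(3) by (intro order_trans[OF emeasure_mono emeasure_gt_rearr[of h]]) auto

lemma rearr_mono:
  assumes "g \<in> borel_measurable M" "h \<in> borel_measurable M"
    and "\<And>x. x \<in> space M \<Longrightarrow> g x \<le> h x"
  shows "rearr M g u \<le> rearr M h u"
  using assms by (intro rearr_le_of_level_sets[of g M h]) (auto intro: less_le_trans)

text \<open>Where the supremum exceeds the right-hand side, some \<open>g i\<close> exceeds its own
  level at \<open>u / card I\<close>, and these \<open>card I\<close> exceptional sets have total
  measure at most \<open>u\<close>.\<close>

lemma rearr_SUP_le:
  assumes I: "finite I" "I \<noteq> {}" and [measurable]: "\<And>i. i \<in> I \<Longrightarrow> g i \<in> borel_measurable M" and u: "0 \<le> u"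
  shows "rearr M (\<lambda>x. SUP i\<in>I. g i x) u \<le> (SUP i\<in>I. rearr M (g i) (u / card I))"
proof -
  have [measurable]: "(\<lambda>x. SUP i\<in>I. g i x) \<in> borel_measurable M"
    using I by (intro borel_measurable_SUP) (auto intro: countable_finite)
  let ?S = "SUP i\<in>I. rearr M (g i) (u / card I)"
  have "emeasure M {x\<in>space M. ?S < (SUP i\<in>I. g i x)}
      \<le> emeasure M (\<Union>i\<in>I. {x\<in>space M. rearr M (g i) (u / card I) < g i x})"
    using I by (intro emeasure_mono) (auto simp: less_SUP_iff intro: le_less_trans[OF SUP_upper])
  also have "\<dots> \<le> (\<Sum>i\<in>I. emeasure M {x\<in>space M. rearr M (g i) (u / card I) < g i x})"
    using I by (intro emeasure_subadditive_finite) auto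
  also have "\<dots> \<le> (\<Sum>i\<in>I. ennreal (u / card I))"
    by (intro sum_mono emeasure_gt_rearr) auto
  also have "\<dots> = ennreal u"
    using I u by (simp add: ennreal_of_nat_eq_real_of_nat ennreal_mult[symmetric])
  finally show ?thesis by (simp add: rearr_le_iff)
qed

lemma rearr_max_le:
  assumes [measurable]: "g \<in> borel_measurable M" "h \<in> borel_measurable M" and "0 \<le> u"
  shows "rearr M (\<lambda>x. max (g x) (h x)) u \<le> max (rearr M g (u / 2)) (rearr M h (u / 2))"
proof -
  have "(\<lambda>x. max (g x) (h x)) = (\<lambda>x. SUP b\<in>UNIV. (if b then g else h) x)"
    by (auto simp: UNIV_bool sup_max max.commute)
  then show ?thesis
    using rearr_SUP_le[of UNIV "\<lambda>b. if b then g else h" M u] assms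
    by (simp add: UNIV_bool sup_max max.commute)
qed

lemma rearr_powr_le:
  assumes [measurable]: "g \<in> borel_measurable M" "h \<in> borel_measurable M"
    and a: "0 < a" and le: "\<And>x. x \<in> space M \<Longrightarrow> g x \<le> c * ennreal_powr (h x) a"
  shows "rearr M g u \<le> c * ennreal_powr (rearr M h u) a"
proof (rule rearr_le_of_level_sets[of g M h])
  fix x assume x: "x \<in> space M" "c * ennreal_powr (rearr M h u) a < g x"
  show "rearr M h u < h x"
  proof (rule ccontr)
    assume "\<not> rearr M h u < h x"
    then have "c * ennreal_powr (h x) a \<le> c * ennreal_powr (rearr M h u) a"
      using a by (intro mult_left_mono ennreal_powr_mono) auto
    with x le[of x] show False by auto
  qed
qed auto

text \<open>Split \<open>{h > rearr h u}\<close> along the levels \<open>rearr h (u / 2 ^ k)\<close>.\<close>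

lemma nn_integral_gt_rearr_le:
  assumes [measurable]: "h \<in> borel_measurable M" and u: "0 < u"
  shows "(\<integral>\<^sup>+x. h x * indicator {x. rearr M h u < h x} x \<partial>M)
    \<le> (\<Sum>k. rearr M h (u / 2 ^ Suc k) * ennreal (u / 2 ^ k))"
proof -
  define s where "s k = rearr M h (u / 2 ^ k)" for k
  have D: "emeasure M {x\<in>space M. s k < h x} \<le> ennreal (u / 2 ^ k)" for k
    unfolding s_def by (rule emeasure_gt_rearr) fact
  \<comment> \<open>\<open>E\<close> is where \<open>h\<close> exceeds all levels
    \<open>s k\<close>. It is null because the measures of the superlevel sets tend to zero; outside
    \<open>E\<close> some level reaches \<open>h x\<close>.\<close>
  define E where "E = (\<Inter>k. {x\<in>space M. s k < h x})"
  have [measurable]: "E \<in> sets M" unfolding E_def by measurable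
  have "emeasure M E \<le> ennreal (u / 2 ^ k)" for k
    using D[of k] by (rule order_trans[rotated]) (auto intro!: emeasure_mono simp: E_def)
  moreover have "(\<lambda>k. ennreal (u / 2 ^ k)) \<longlonglongrightarrow> ennreal 0"
    by (intro tendsto_ennrealI LIMSEQ_divide_realpow_zero) auto
  ultimately have "emeasure M E \<le> ennreal 0"
    by (intro LIMSEQ_le_const) auto
  then have AE: "AE x in M. x \<notin> E"
    by (intro AE_not_in) (auto simp: null_sets_def)
  have "(\<integral>\<^sup>+x. h x * indicator {x. rearr M h u < h x} x \<partial>M)
    \<le> (\<integral>\<^sup>+x. (\<Sum>k. s (Suc k) * indicator {x\<in>space M. s k < h x} x) \<partial>M)"
  proof (rule nn_integral_mono_AE)
    show "AE x in M. h x * indicator {x. rearr M h u < h x} x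
        \<le> (\<Sum>k. s (Suc k) * indicator {x\<in>space M. s k < h x} x)"
      using AE AE_space
    proof eventually_elim
      case (elim x)
      note x = elim(1) and xM = elim(2)
      show ?case
      proof (cases "s 0 < h x")
        case True
        obtain n where "h x \<le> s n" using x xM by (auto simp: E_def not_less)
        \<comment> \<open>The first level reaching \<open>h x\<close> has positive index
          \<open>Suc k\<close>: the value is controlled by level \<open>Suc k\<close>, the measure
          by level \<open>k\<close>. This shift is the source of the factors \<open>2\<close> and
          \<open>2 powr (1/p)\<close> in later constants.\<close>
        define m where "m = (LEAST n. h x \<le> s n)"
        have m: "h x \<le> s m" unfolding m_def by (rule LeastI) fact
        with True have "m \<noteq> 0" by (metis leD)
        then obtain k where k: "m = Suc k" by (cases m) auto
        then have "\<not> h x \<le> s k" using not_less_Least[of k "\<lambda>n. h x \<le> s n"] by (simp add: m_def)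
        then have "h x \<le> (\<Sum>k\<in>{k}. s (Suc k) * indicator {x\<in>space M. s k < h x} x)"
          using m k xM by simp
        also have "\<dots> \<le> (\<Sum>k. s (Suc k) * indicator {x\<in>space M. s k < h x} x)"
          by (intro sum_le_suminf) auto
        finally show ?thesis using True by (simp add: s_def)
      qed (simp add: s_def)
    qed
  qed
  also have "\<dots> = (\<Sum>k. s (Suc k) * emeasure M {x\<in>space M. s k < h x})"
    by (subst nn_integral_suminf) (auto simp: nn_integral_cmult_indicator)
  also have "\<dots> \<le> (\<Sum>k. s (Suc k) * ennreal (u / 2 ^ k))"
    by (intro suminf_le mult_left_mono D) auto
  finally show ?thesis unfolding s_def .
qed

section \<open>Dyadic cubes and the dyadic maximal operator\<close>

text \<open>Cubes of generation \<open>j\<close> become the level sets of one function, so that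
  nesting and adjacency turn into integer arithmetic.\<close>

definition dyadic_index :: "int \<Rightarrow> real^'n \<Rightarrow> int^'n" where
  "dyadic_index j x = (\<chi> i. \<lfloor>2 powi j * x $ i\<rfloor>)"

definition dyadic_shift :: "int \<Rightarrow> int^'n \<Rightarrow> real^'n" where
  "dyadic_shift j e = (\<chi> i. 2 powi (-j) * of_int (e $ i))"

text \<open>Index of the \<open>i\<close>-th ancestor; \<open>div\<close> rounds towards minus
  infinity, as negative indices require.\<close>

definition dyadic_parent :: "nat \<Rightarrow> int^'n \<Rightarrow> int^'n" where
  "dyadic_parent i k = (\<chi> l. k $ l div 2 ^ i)"

text \<open>Steps from a cube to itself and to all cubes touching it, corners included.\<close>

definition dyadic_offsets :: "(int^'n) set" where
  "dyadic_offsets = {e. \<forall>i. \<bar>e $ i\<bar> \<le> 1}"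

lemma finite_dyadic_offsets [simp]: "finite (dyadic_offsets :: (int^'n) set)"
proof -
  have "(dyadic_offsets :: (int^'n) set) \<subseteq> vec_lambda ` (UNIV \<rightarrow>\<^sub>E {-1..1})"
  proof
    fix e :: "int^'n" assume "e \<in> dyadic_offsets"
    then have "e = vec_lambda (vec_nth e)" "vec_nth e \<in> UNIV \<rightarrow>\<^sub>E {-1..1}"
      by (auto simp: dyadic_offsets_def abs_le_iff minus_le_iff)
    then show "e \<in> vec_lambda ` (UNIV \<rightarrow>\<^sub>E {-1..1})" by blast
  qed
  then show ?thesis by (rule finite_subset) (auto intro!: finite_imageI finite_PiE)
qed

lemma zero_in_dyadic_offsets [simp]: "0 \<in> dyadic_offsets"
  by (simp add: dyadic_offsets_def)

lemma dyadic_offsets_nonempty [simp]: "dyadic_offsets \<noteq> {}"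
  using zero_in_dyadic_offsets by blast

lemma card_dyadic_offsets_pos [simp]: "0 < card (dyadic_offsets :: (int^'n) set)"
  by (simp add: card_gt_0_iff)

lemma mem_dyadic_cube: "x \<in> dyadic_cube j k \<longleftrightarrow> dyadic_index j x = k"
proof -
  have "(2 powi (-j) * of_int m \<le> y \<and> y < 2 powi (-j) * (of_int m + 1)) \<longleftrightarrow> \<lfloor>2 powi j * y\<rfloor> = m" for m and y :: real
    by (simp add: floor_eq_iff power_int_minus field_simps)
  then show ?thesis
    by (simp add: dyadic_cube_def dyadic_index_def vec_eq_iff)
qed

lemma dyadic_index_shift: "dyadic_index j (x + dyadic_shift j e) = dyadic_index j x + e"
proof -
  have "2 powi j * (y + 2 powi (-j) * of_int m) = 2 powi j * y + of_int m" for m and y :: real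
    by (simp add: power_int_minus field_simps)
  then show ?thesis
    by (simp add: dyadic_index_def dyadic_shift_def vec_eq_iff)
qed

lemma ex_dyadic_index: "\<exists>x. dyadic_index j x = k"
proof
  show "dyadic_index j (0 + dyadic_shift j k) = k"
    unfolding dyadic_index_shift by (simp add: dyadic_index_def vec_eq_iff)
qed

lemma dyadic_index_parent: "dyadic_index (j - int i) x = dyadic_parent i (dyadic_index j x)"
proof -
  have "\<lfloor>2 powi (j - int i) * y\<rfloor> = \<lfloor>2 powi j * y\<rfloor> div 2 ^ i" for y :: real
    using floor_divide_real_eq_div[of "2 ^ i" "2 powi j * y"] by (simp add: power_int_diff)
  then show ?thesis
    by (simp add: dyadic_index_def dyadic_parent_def vec_eq_iff)
qed

lemma dyadic_index_coarser:
  assumes "dyadic_index j x = dyadic_index j y" "i \<le> j"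
  shows "dyadic_index i x = dyadic_index i y"
  using assms dyadic_index_parent[of j "nat (j - i)" x] dyadic_index_parent[of j "nat (j - i)" y] by simp

text \<open>Rounding down preserves a gap of at most one, since \<open>b \<le> a + 1\<close> gives
  \<open>b \<le> a + 2 ^ i\<close>. This lets neighbours be followed to coarser generations.\<close>

lemma dyadic_parent_offset:
  assumes "k' - k \<in> dyadic_offsets"
  shows "dyadic_parent i k' - dyadic_parent i k \<in> dyadic_offsets"
proof -
  have *: "b div 2 ^ i \<le> a div 2 ^ i + 1" if "b \<le> a + 1" for a b :: int
  proof -
    have "b \<le> a + 2 ^ i" using that one_le_power[of "2::int" i] by linarith
    then have "b div 2 ^ i \<le> (a + 2 ^ i) div 2 ^ i" by (intro zdiv_mono1) auto
    then show ?thesis by simp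
  qed
  show ?thesis
    unfolding dyadic_offsets_def
  proof (safe)
    fix l
    have "k' $ l \<le> k $ l + 1" "k $ l \<le> k' $ l + 1"
      using assms by (auto simp: dyadic_offsets_def abs_le_iff algebra_simps)
    then show "\<bar>(dyadic_parent i k' - dyadic_parent i k) $ l\<bar> \<le> 1"
      using *[of "k' $ l" "k $ l"] *[of "k $ l" "k' $ l"] by (simp add: dyadic_parent_def abs_le_iff)
  qed
qed

lemma dyadic_index_offset_coarser:
  assumes "dyadic_index j y - dyadic_index j x \<in> dyadic_offsets" "i \<le> j"
  shows "dyadic_index i y - dyadic_index i x \<in> dyadic_offsets"
  using assms dyadic_parent_offset[of "dyadic_index j y" "dyadic_index j x" "nat (j - i)"]
    dyadic_index_parent[of j "nat (j - i)" x] dyadic_index_parent[of j "nat (j - i)" y] by simp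

lemma borel_dyadic_cube [measurable]: "dyadic_cube j k \<in> sets borel"
  unfolding dyadic_cube_def by measurable

lemma measurable_dyadic_index [measurable]:
  "(dyadic_index j :: real^'n \<Rightarrow> int^'n) \<in> borel \<rightarrow>\<^sub>M count_space UNIV"
proof -
  have "dyadic_index j -` {k} = dyadic_cube j k" for k :: "int^'n"
    by (auto simp: mem_dyadic_cube)
  then show ?thesis
    by (simp add: measurable_count_space_eq2_countable)
qed

lemma measurable_dyadic_index_lebesgue [measurable]: "dyadic_index j \<in> lebesgue \<rightarrow>\<^sub>M count_space UNIV"
  by (intro measurable_completion) simp

lemma lebesgue_dyadic_cube [measurable]: "dyadic_cube j k \<in> sets lebesgue"
  by (intro sets_completionI_sets) simp

lemma emeasure_dyadic_cube:
  "emeasure lebesgue (dyadic_cube j (k :: int^'n)) = ennreal (2 powr (- of_int j * real CARD('n)))"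
proof -
  define a b :: "real^'n" where "a = dyadic_shift j k" and "b = dyadic_shift j (k + 1)"
  have ba: "(b - a) \<bullet> e = 2 powi (-j)" if "e \<in> Basis" for e :: "real^'n"
    using that by (auto simp: a_def b_def dyadic_shift_def Basis_vec_def inner_axis algebra_simps)
  then have le: "a \<bullet> e \<le> b \<bullet> e" if "e \<in> Basis" for e
    using that by (metis inner_diff_left diff_ge_0_iff_ge zero_le_numeral zero_le_power_int)
  have vol: "(\<Prod>e\<in>Basis. (b - a) \<bullet> e) = 2 powr (- of_int j * real CARD('n))"
    using ba by (simp add: powr_realpow[symmetric] powr_powr powr_real_of_int'[symmetric])
  have "box a b \<subseteq> dyadic_cube j k" "dyadic_cube j k \<subseteq> cbox a b"
    by (auto simp: dyadic_cube_def a_def b_def dyadic_shift_def mem_box_cart less_imp_le)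
  then have "emeasure lborel (box a b) \<le> emeasure lborel (dyadic_cube j k)"
    "emeasure lborel (dyadic_cube j k) \<le> emeasure lborel (cbox a b)"
    by (auto intro!: emeasure_mono)
  then show ?thesis
    using le by (simp add: emeasure_lborel_box emeasure_lborel_cbox vol)
qed

lemma nn_integral_dyadic_cubes:
  fixes h :: "real^'n \<Rightarrow> ennreal"
  assumes [measurable]: "h \<in> borel_measurable lebesgue"
  shows "(\<integral>\<^sup>+x. h x \<partial>lebesgue) = (\<integral>\<^sup>+k. (\<integral>\<^sup>+x\<in>dyadic_cube j k. h x \<partial>lebesgue) \<partial>count_space UNIV)"
proof -
  have "h x = (\<integral>\<^sup>+k. h x * indicator (dyadic_cube j k) x \<partial>count_space UNIV)" for x
    by (subst nn_integral_count_space'[of "{dyadic_index j x}"]) (auto simp: mem_dyadic_cube indicator_def)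
  then have "(\<integral>\<^sup>+x. h x \<partial>lebesgue) = (\<integral>\<^sup>+x. \<integral>\<^sup>+k. h x * indicator (dyadic_cube j k) x \<partial>count_space UNIV \<partial>lebesgue)"
    by simp
  also have "\<dots> = (\<integral>\<^sup>+k. (\<integral>\<^sup>+x\<in>dyadic_cube j k. h x \<partial>lebesgue) \<partial>count_space UNIV)"
    by (rule nn_integral_count_space_nn_integral) auto
  finally show ?thesis .
qed

text \<open>A function of the index is a step function on the cubes. Read backwards, the formula
  turns sums over the indices of a generation into Lebesgue integrals, where different generations
  can be compared.\<close>

lemma nn_integral_dyadic_index:
  fixes \<Psi> :: "int^'n \<Rightarrow> ennreal"
  shows "(\<integral>\<^sup>+x. \<Psi> (dyadic_index j x) \<partial>lebesgue)
    = ennreal (2 powr (- of_int j * real CARD('n))) * (\<integral>\<^sup>+k. \<Psi> k \<partial>count_space UNIV)"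
proof -
  have "(\<integral>\<^sup>+x\<in>dyadic_cube j k. \<Psi> (dyadic_index j x) \<partial>lebesgue) = ennreal (2 powr (- of_int j * real CARD('n))) * \<Psi> k" for k
  proof -
    have "(\<integral>\<^sup>+x\<in>dyadic_cube j k. \<Psi> (dyadic_index j x) \<partial>lebesgue) = (\<integral>\<^sup>+x. \<Psi> k * indicator (dyadic_cube j k) x \<partial>lebesgue)"
      by (intro nn_integral_cong) (auto simp: mem_dyadic_cube indicator_def)
    then show ?thesis
      by (simp add: nn_integral_cmult_indicator emeasure_dyadic_cube mult.commute)
  qed
  then show ?thesis
    by (subst nn_integral_dyadic_cubes[of _ j]) (simp_all add: nn_integral_cmult)
qed

section \<open>Dyadic averages and the weak type inequality\<close>

definition dyadic_avg :: "(real^'n \<Rightarrow> ennreal) \<Rightarrow> int \<Rightarrow> int^'n \<Rightarrow> ennreal" where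
  "dyadic_avg h j k = ennreal (2 powr (of_int j * real CARD('n))) * (\<integral>\<^sup>+x\<in>dyadic_cube j k. h x \<partial>lebesgue)"

definition dyadic_maximal :: "(real^'n \<Rightarrow> ennreal) \<Rightarrow> real^'n \<Rightarrow> ennreal" where
  "dyadic_maximal h x = (SUP j. SUP e\<in>dyadic_offsets. dyadic_avg h j (dyadic_index j x + e))"

lemma dyadic_avg_le_maximal:
  "e \<in> dyadic_offsets \<Longrightarrow> dyadic_avg h j (dyadic_index j x + e) \<le> dyadic_maximal h x"
  unfolding dyadic_maximal_def by (intro SUP_upper2[of j] SUP_upper2[of e]) auto

lemma measurable_dyadic_maximal [measurable]: "dyadic_maximal h \<in> borel_measurable lebesgue"
proof -
  have [measurable]: "(\<lambda>k. dyadic_avg h j (k + e)) \<in> count_space UNIV \<rightarrow>\<^sub>M borel" for j e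
    by simp
  show ?thesis
    unfolding dyadic_maximal_def by (intro borel_measurable_SUP) (auto intro: countable_finite)
qed

lemma emeasure_UN_le_nn_integral_count_space:
  assumes I: "countable I" and [measurable]: "\<And>i. i \<in> I \<Longrightarrow> X i \<in> sets M"
  shows "emeasure M (\<Union>i\<in>I. X i) \<le> (\<integral>\<^sup>+i. emeasure M (X i) \<partial>count_space I)"
proof -
  have "emeasure M (\<Union>i\<in>I. X i) = (\<integral>\<^sup>+x. indicator (\<Union>i\<in>I. X i) x \<partial>M)"
    using I by (intro nn_integral_indicator[symmetric]) auto
  also have "\<dots> \<le> (\<integral>\<^sup>+x. \<integral>\<^sup>+i. indicator (X i) x \<partial>count_space I \<partial>M)"
  proof (rule nn_integral_mono)
    fix x
    show "indicator (\<Union>i\<in>I. X i) x \<le> (\<integral>\<^sup>+i. indicator (X i) x \<partial>count_space I :: ennreal)"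
    proof (cases "x \<in> (\<Union>i\<in>I. X i)")
      case True
      then obtain i where "i \<in> I" "x \<in> X i" by auto
      then show ?thesis
        using nn_integral_ge_point[of i I "\<lambda>i. indicator (X i) x"] True by simp
    qed simp
  qed
  also have "\<dots> = (\<integral>\<^sup>+i. emeasure M (X i) \<partial>count_space I)"
    by (subst nn_integral_count_space_nn_integral) (auto simp: I intro!: nn_integral_cong)
  finally show ?thesis .
qed

lemma emeasure_lebesgue_vimage_plus:
  fixes S :: "'a :: euclidean_space set"
  assumes [measurable]: "S \<in> sets borel"
  shows "emeasure lebesgue {x. x + c \<in> S} = emeasure lebesgue S"
proof -
  have "emeasure lborel S = emeasure (distr lborel borel ((+) c)) S"
    by (simp add: lborel_distr_plus)
  also have "\<dots> = emeasure lborel {x. x + c \<in> S}"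
    by (subst emeasure_distr) (auto simp: vimage_def add.commute)
  finally show ?thesis
    by simp
qed

text \<open>A cube of average larger than \<open>l\<close> lies in a maximal such cube \<open>Q'\<close>, and its
  neighbours of the same generation lie in \<open>Q'\<close> or in a neighbour of \<open>Q'\<close>.\<close>

lemma dyadic_maximal_weak_type:
  fixes h :: "real^'n \<Rightarrow> ennreal"
  assumes [measurable]: "h \<in> borel_measurable lebesgue"
  shows "l * emeasure lebesgue {x. l < dyadic_maximal h x}
    \<le> of_nat (card (dyadic_offsets :: (int^'n) set)) * (\<integral>\<^sup>+x. h x \<partial>lebesgue)"
\<comment> \<open>In these cases one side is trivial; for \<open>l = top\<close> the superlevel set
  is empty. Afterwards the integral is finite, which is what guarantees maximal cubes.\<close>
proof (cases "l = 0 \<or> l = top \<or> (\<integral>\<^sup>+x. h x \<partial>lebesgue) = top")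
  case True
  then show ?thesis by (auto simp: ennreal_mult_top)
next
  case False
  then obtain l' where l': "l = ennreal l'" "0 < l'"
    by (cases l) (auto simp: ennreal_eq_0_iff)
  from False obtain H where H: "(\<integral>\<^sup>+x. h x \<partial>lebesgue) = ennreal H" "0 \<le> H"
    by (cases "\<integral>\<^sup>+x. h x \<partial>lebesgue") auto
  \<comment> \<open>\<open>E j\<close> consists of the cubes of generation \<open>j\<close> with
    average above \<open>l\<close>, and \<open>F j\<close> of those among them without such a proper
    ancestor. Smaller \<open>j\<close> means larger cubes.\<close>
  define E where "E j = {x. l < dyadic_avg h j (dyadic_index j x)}" for j
  define F where "F j = E j - (\<Union>i\<in>{..<j}. E i)" for j
  have [measurable]: "E j \<in> sets borel" for j
  proof -
    have "Measurable.pred (count_space UNIV) (\<lambda>k. l < dyadic_avg h j k)" by simp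
    from measurable_compose[OF measurable_dyadic_index this]
    show ?thesis unfolding E_def by (simp add: pred_def)
  qed
  have [measurable]: "F j \<in> sets borel" for j
    unfolding F_def by (intro sets.Diff sets.countable_UN') auto
  have [measurable]: "F j \<in> sets lebesgue" for j
    using \<open>F j \<in> sets borel\<close> by auto
  have sat: "y \<in> F j" if "x \<in> F j" "dyadic_index j x = dyadic_index j y" for x y j
    using that dyadic_index_coarser[OF that(2)] by (auto simp: F_def E_def)
  \<comment> \<open>Averages over cubes of generation at most \<open>- m\<close> are at most
    \<open>H / 2 ^ m\<close>, hence below \<open>l\<close>. This bounds the generations occurring in
    \<open>E\<close> from below.\<close>
  obtain m :: nat where m: "H / l' < 2 ^ m"
    using real_arch_pow[of 2 "H / l'"] by auto
  have lower: "- int m < j" if "y \<in> E j" for y j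
  proof (rule ccontr)
    assume "\<not> - int m < j"
    then have "real_of_int j * real CARD('n) \<le> - real m * real CARD('n)"
      by (intro mult_right_mono) auto
    also have "\<dots> \<le> - real m * 1"
      by (intro mult_left_mono_neg) (auto simp: Suc_leI)
    finally have "real_of_int j * real CARD('n) \<le> - real m" by simp
    moreover have "(\<integral>\<^sup>+x\<in>dyadic_cube j k. h x \<partial>lebesgue) \<le> ennreal H" for k
      unfolding H(1)[symmetric] by (intro nn_integral_mono) (auto split: split_indicator)
    ultimately have "l < ennreal (2 powr (- real m)) * ennreal H"
      using that unfolding E_def dyadic_avg_def
      by (auto elim!: less_le_trans intro!: mult_mono ennreal_leI powr_mono)
    then have "l' < 2 powr (- real m) * H"
      using l' H by (simp add: ennreal_mult[symmetric] ennreal_less_iff)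
    with m l' show False
      by (simp add: powr_minus powr_realpow field_simps)
  qed
  have cover: "{x. l < dyadic_maximal h x} \<subseteq> (\<Union>j. \<Union>e\<in>dyadic_offsets. {x. x + dyadic_shift j e \<in> F j})"
  proof safe
    fix x assume "l < dyadic_maximal h x"
    then obtain j e where e: "e \<in> dyadic_offsets" "l < dyadic_avg h j (dyadic_index j x + e)"
      by (auto simp: dyadic_maximal_def less_SUP_iff)
    define y where "y = x + dyadic_shift j e"
    have idx: "dyadic_index j y = dyadic_index j x + e"
      by (simp add: y_def dyadic_index_shift)
    then have "y \<in> E j" using e by (simp add: E_def)
    from lower[OF this] this have "y \<in> E (int (nat (j + int m)) - int m)" by simp
    \<comment> \<open>The order on \<open>int\<close> is not well-founded, so the generation is
      shifted by \<open>m\<close> before the least one is taken.\<close>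
    define i where "i = (LEAST i. y \<in> E (int i - int m))"
    have iE: "y \<in> E (int i - int m)"
      unfolding i_def by (rule LeastI) fact
    have least: "int i - int m \<le> j'" if "y \<in> E j'" for j'
    proof -
      have "i \<le> nat (j' + int m)"
        unfolding i_def using lower[OF that] that by (intro Least_le) simp
      then show ?thesis using lower[OF that] by linarith
    qed
    define j' where "j' = int i - int m"
    have F: "y \<in> F j'"
      using iE least by (force simp: F_def j'_def)
    have "j' \<le> j" using least[OF \<open>y \<in> E j\<close>] by (simp add: j'_def)
    define e' where "e' = dyadic_index j' y - dyadic_index j' x"
    have "e' \<in> dyadic_offsets"
      unfolding e'_def
    proof (rule dyadic_index_offset_coarser)
      show "dyadic_index j y - dyadic_index j x \<in> dyadic_offsets"
        using e(1) by (simp only: idx add_diff_cancel_left')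
    qed fact
    \<comment> \<open>The translate of \<open>x\<close> need not be \<open>y\<close>, but it has the
      same index at generation \<open>j'\<close>, and \<open>F j'\<close> is a union of cubes of
      that generation.\<close>
    moreover have "x + dyadic_shift j' e' \<in> F j'"
      using F by (rule sat) (simp only: dyadic_index_shift e'_def, simp)
    ultimately show "x \<in> (\<Union>j. \<Union>e\<in>dyadic_offsets. {x. x + dyadic_shift j e \<in> F j})" by blast
  qed
  have shift: "{x. x + dyadic_shift j e \<in> F j} \<in> sets lebesgue" for j e
  proof -
    have "{x. x + dyadic_shift j e \<in> F j} \<in> sets borel" by measurable
    then show ?thesis by auto
  qed
  let ?K = "of_nat (card (dyadic_offsets :: (int^'n) set)) :: ennreal"
  have FI: "l * emeasure lebesgue (F j) \<le> (\<integral>\<^sup>+x\<in>F j. h x \<partial>lebesgue)" for j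
  proof -
    define A where "A = dyadic_index j ` F j"
    have A: "x \<in> F j \<longleftrightarrow> dyadic_index j x \<in> A" for x
      using sat[of _ j x] by (auto simp: A_def)
    have "l * emeasure lebesgue (F j) = (\<integral>\<^sup>+x. l * indicator (F j) x \<partial>lebesgue)"
      by (simp add: nn_integral_cmult_indicator)
    also have "\<dots> \<le> (\<integral>\<^sup>+x. dyadic_avg h j (dyadic_index j x) * indicator A (dyadic_index j x) \<partial>lebesgue)"
      by (intro nn_integral_mono) (auto simp: A[symmetric] F_def E_def split: split_indicator)
    also have "\<dots> = (\<integral>\<^sup>+k. (\<integral>\<^sup>+x\<in>dyadic_cube j k. h x \<partial>lebesgue) * indicator A k \<partial>count_space UNIV)"
      by (subst nn_integral_dyadic_index[where \<Psi> = "\<lambda>k. dyadic_avg h j k * indicator A k"])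
         (simp add: dyadic_avg_def nn_integral_cmult mult.assoc ennreal_mult[symmetric] powr_add[symmetric]
           flip: mult.assoc[of "ennreal _" "ennreal _"])
    also have "\<dots> = (\<integral>\<^sup>+k. (\<integral>\<^sup>+x\<in>dyadic_cube j k. h x * indicator (F j) x \<partial>lebesgue) \<partial>count_space UNIV)"
      by (subst nn_integral_multc[symmetric])
         (auto simp: mem_dyadic_cube A split: split_indicator intro!: nn_integral_cong)
    also have "\<dots> = (\<integral>\<^sup>+x\<in>F j. h x \<partial>lebesgue)"
      by (rule nn_integral_dyadic_cubes[symmetric]) simp
    finally show ?thesis .
  qed
  have "emeasure lebesgue {x. l < dyadic_maximal h x}
    \<le> emeasure lebesgue (\<Union>j. \<Union>e\<in>dyadic_offsets. {x. x + dyadic_shift j e \<in> F j})"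
    by (intro emeasure_mono cover sets.countable_UN' shift) (auto intro: countable_finite)
  also have "\<dots> \<le> (\<integral>\<^sup>+j. emeasure lebesgue (\<Union>e\<in>dyadic_offsets. {x. x + dyadic_shift j e \<in> F j}) \<partial>count_space UNIV)"
    by (intro emeasure_UN_le_nn_integral_count_space sets.countable_UN' shift) (auto intro: countable_finite)
  also have "\<dots> \<le> (\<integral>\<^sup>+j. ?K * emeasure lebesgue (F j) \<partial>count_space UNIV)"
  proof (rule nn_integral_mono)
    fix j
    have "emeasure lebesgue (\<Union>e\<in>dyadic_offsets. {x. x + dyadic_shift j e \<in> F j})
      \<le> (\<Sum>e\<in>dyadic_offsets. emeasure lebesgue {x. x + dyadic_shift j e \<in> F j})"
      by (intro emeasure_subadditive_finite) (use shift in auto)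
    also have "\<dots> = ?K * emeasure lebesgue (F j)"
      by (simp only: emeasure_lebesgue_vimage_plus[OF \<open>F j \<in> sets borel\<close>] sum_constant)
    finally show "emeasure lebesgue (\<Union>e\<in>dyadic_offsets. {x. x + dyadic_shift j e \<in> F j}) \<le> ?K * emeasure lebesgue (F j)" .
  qed
  finally have "l * emeasure lebesgue {x. l < dyadic_maximal h x}
     \<le> l * (?K * (\<integral>\<^sup>+j. emeasure lebesgue (F j) \<partial>count_space UNIV))"
    by (intro mult_left_mono) (auto simp: nn_integral_cmult)
  also have "\<dots> = ?K * (\<integral>\<^sup>+j. l * emeasure lebesgue (F j) \<partial>count_space UNIV)"
    by (simp add: nn_integral_cmult ac_simps)
  also have "\<dots> \<le> ?K * (\<integral>\<^sup>+j. (\<integral>\<^sup>+x\<in>F j. h x \<partial>lebesgue) \<partial>count_space UNIV)"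
    by (intro mult_left_mono nn_integral_mono FI) auto
  also have "(\<integral>\<^sup>+j. (\<integral>\<^sup>+x\<in>F j. h x \<partial>lebesgue) \<partial>count_space UNIV)
      = (\<integral>\<^sup>+x. (\<integral>\<^sup>+j. h x * indicator (F j) x \<partial>count_space UNIV) \<partial>lebesgue)"
    by (rule nn_integral_count_space_nn_integral[symmetric]) auto
  also have "\<dots> \<le> (\<integral>\<^sup>+x. h x \<partial>lebesgue)"
  proof (rule nn_integral_mono)
    fix x
    show "(\<integral>\<^sup>+j. h x * indicator (F j) x \<partial>count_space UNIV) \<le> h x"
    proof (cases "\<exists>j. x \<in> F j")
      case True
      then obtain j where j: "x \<in> F j" by auto
      have "x \<notin> F i" if "i \<noteq> j" for i
        using j that by (cases i j rule: linorder_cases) (auto simp: F_def)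
      then have "(\<integral>\<^sup>+j. h x * indicator (F j) x \<partial>count_space UNIV) = h x"
        using j by (subst nn_integral_count_space'[of "{j}"]) auto
      then show ?thesis by simp
    qed simp
  qed
  finally show ?thesis
    by (simp add: mult_left_mono)
qed

section \<open>From the weak type inequality to Lorentz spaces\<close>

lemma dyadic_avg_mono: "(\<And>x. g x \<le> h x) \<Longrightarrow> dyadic_avg g j k \<le> dyadic_avg h j k"
  unfolding dyadic_avg_def by (intro mult_left_mono nn_integral_mono mult_right_mono) auto

lemma dyadic_maximal_mono: "(\<And>x. g x \<le> h x) \<Longrightarrow> dyadic_maximal g x \<le> dyadic_maximal h x"
  unfolding dyadic_maximal_def by (intro SUP_mono' dyadic_avg_mono) auto

lemma dyadic_maximal_const_add:
  fixes h :: "real^'n \<Rightarrow> ennreal"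
  assumes [measurable]: "h \<in> borel_measurable lebesgue"
  shows "dyadic_maximal (\<lambda>x. c + h x) x \<le> c + dyadic_maximal h x"
proof -
  have "dyadic_avg (\<lambda>x. c + h x) j k = c + dyadic_avg h j k" for j k
  proof -
    have "(\<integral>\<^sup>+x\<in>dyadic_cube j k. (c + h x) \<partial>lebesgue)
      = c * ennreal (2 powr (- of_int j * real CARD('n))) + (\<integral>\<^sup>+x\<in>dyadic_cube j k. h x \<partial>lebesgue)"
      by (simp add: distrib_right nn_integral_add nn_integral_cmult_indicator emeasure_dyadic_cube)
    moreover have "ennreal (2 powr (of_int j * real CARD('n))) * (c * ennreal (2 powr (- of_int j * real CARD('n)))) = c"
      by (simp add: mult.left_commute[of _ c] ennreal_mult[symmetric] powr_add[symmetric])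
    ultimately show ?thesis
      unfolding dyadic_avg_def by (simp only: distrib_left)
  qed
  then show ?thesis
    unfolding dyadic_maximal_def
    by (auto intro!: SUP_least add_left_mono dyadic_avg_le_maximal[unfolded dyadic_maximal_def])
qed

text \<open>Truncation at the height \<open>s\<close> of the rearrangement: the part of
  \<open>h\<close> up to \<open>s\<close> contributes at most \<open>s\<close> to the maximal
  function, and the weak type inequality handles the part \<open>g\<close> above
  \<open>s\<close>.\<close>

lemma rearr_dyadic_maximal_le:
  fixes h :: "real^'n \<Rightarrow> ennreal"
  assumes [measurable]: "h \<in> borel_measurable lebesgue" and u: "0 < u"
  shows "rearr lebesgue (dyadic_maximal h) u \<le> rearr lebesgue h u
    + ennreal (card (dyadic_offsets :: (int^'n) set) / u) * (\<integral>\<^sup>+x. h x * indicator {x. rearr lebesgue h u < h x} x \<partial>lebesgue)"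
proof -
  let ?K = "card (dyadic_offsets :: (int^'n) set)"
  define s where "s = rearr lebesgue h u"
  define g where "g x = h x * indicator {x. s < h x} x" for x
  have [measurable]: "g \<in> borel_measurable lebesgue"
    unfolding g_def by measurable
  \<comment> \<open>With this level the weak type inequality for \<open>g\<close> bounds the measure
    of the superlevel set by exactly \<open>u\<close>.\<close>
  define l where "l = ennreal (?K / u) * (\<integral>\<^sup>+x. g x \<partial>lebesgue)"
  have "dyadic_maximal h x \<le> s + dyadic_maximal g x" for x
    by (rule order_trans[OF dyadic_maximal_mono dyadic_maximal_const_add])
       (auto simp: g_def split: split_indicator)
  then have sub: "{x. s + l < dyadic_maximal h x} \<subseteq> {x. l < dyadic_maximal g x}"
    by (intro Collect_mono impI)
       (meson add_left_mono leD leI order_trans)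
  have "emeasure lebesgue {x. l < dyadic_maximal g x} \<le> ennreal u"
  proof (cases "l = top \<or> l = 0")
    \<comment> \<open>Division by \<open>l\<close> is impossible here. If \<open>l = 0\<close>, then
      \<open>g\<close> vanishes almost everywhere, so all its averages vanish and its maximal
      function is zero at every point.\<close>
    case True
    then show ?thesis
    proof
      assume "l = 0"
      then have "(\<integral>\<^sup>+x. g x \<partial>lebesgue) = 0"
        using u by (auto simp: l_def ennreal_eq_0_iff divide_le_0_iff)
      then have "dyadic_avg g j k = 0" for j k
        by (auto simp: dyadic_avg_def nn_integral_0_iff_AE)
      then have "dyadic_maximal g x = 0" for x
        by (simp add: dyadic_maximal_def)
      then show ?thesis by simp
    qed auto
  next
    case False
    have "l * emeasure lebesgue {x. l < dyadic_maximal g x} \<le> of_nat ?K * (\<integral>\<^sup>+x. g x \<partial>lebesgue)"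
      by (rule dyadic_maximal_weak_type) simp
    also have "\<dots> = l * ennreal u"
    proof -
      have "ennreal (?K / u) * ennreal u = of_nat ?K"
        using u by (simp add: ennreal_mult[symmetric] ennreal_of_nat_eq_real_of_nat)
      then show ?thesis unfolding l_def by (metis mult.assoc mult.commute)
    qed
    finally show ?thesis
      using False by (simp add: ennreal_mult_le_mult_iff)
  qed
  then have "emeasure lebesgue {x. s + l < dyadic_maximal h x} \<le> ennreal u"
  proof (rule order_trans[OF emeasure_mono[OF sub], rotated])
    have "{x \<in> space lebesgue. l < dyadic_maximal g x} \<in> sets lebesgue" by measurable
    then show "{x. l < dyadic_maximal g x} \<in> sets lebesgue" by simp
  qed
  then have "rearr lebesgue (dyadic_maximal h) u \<le> s + l"
    by (simp add: rearr_le_iff)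
  then show ?thesis
    by (simp add: s_def l_def g_def)
qed

lemma suminf_geometric_ennreal:
  "0 \<le> x \<Longrightarrow> x < 1 \<Longrightarrow> (\<Sum>k. ennreal (x ^ k)) = ennreal (1 / (1 - x))"
  by (subst suminf_ennreal2) (auto simp: suminf_geometric summable_geometric)

text \<open>The geometric factor \<open>2 powr (- \<epsilon> k)\<close> is summed, and the supremum of the remaining terms
  replaces Minkowski's inequality.\<close>

lemma lorentz_dyadic_maximal:
  fixes p q :: real
  assumes p: "1 < p" and q: "0 < q"
  shows "\<exists>C>0. \<forall>h :: real^'n \<Rightarrow> ennreal. h \<in> borel_measurable lebesgue \<longrightarrow>
    lorentz_fun p q (rearr lebesgue (dyadic_maximal h)) \<le> ennreal C * lorentz_fun p q (rearr lebesgue h)"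
proof -
  define K where "K = real (card (dyadic_offsets :: (int^'n) set))"
  \<comment> \<open>\<open>\<delta>\<close> is the midpoint of \<open>1/p\<close> and
    \<open>1\<close>, so that \<open>\<epsilon>\<close> and \<open>\<delta> - 1/p\<close> are both
    positive.\<close>
  define \<delta> \<epsilon> where "\<delta> = (1 + 1/p) / 2" and "\<epsilon> = 1 - \<delta>"
  have d: "1/p < \<delta>" "0 < \<epsilon>" using p by (auto simp: \<delta>_def \<epsilon>_def field_simps)
  \<comment> \<open>The summand \<open>1\<close> pays for the truncation height, \<open>K\<close> is
    the weak type constant, and \<open>2\<close> comes from the shift between level and measure.
    \<open>G\<close> sums the Lorentz functionals of the dilates.\<close>
  define B where "B = 1 + K * (2 / (1 - 2 powr - \<epsilon>))"
  define G where "G = 1 / (1 - 2 powr (- q * (\<delta> - 1/p)))"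
  have small: "2 powr - \<epsilon> < (1::real)" "2 powr (- q * (\<delta> - 1/p)) < (1::real)"
    using d q powr_less_mono[of "- \<epsilon>" 0 "2::real"] powr_less_mono[of "- q * (\<delta> - 1/p)" 0 "2::real"]
    by (simp_all add: mult_less_0_iff)
  have "0 < K" by (simp add: K_def)
  then have "1 \<le> B" using small by (simp add: B_def)
  have "0 < G" using small by (simp add: G_def)
  have "lorentz_fun p q (rearr lebesgue (dyadic_maximal h)) \<le> ennreal (B powr q * G) * lorentz_fun p q (rearr lebesgue h)"
    if [measurable]: "h \<in> borel_measurable lebesgue" for h :: "real^'n \<Rightarrow> ennreal"
  proof -
    let ?R = "rearr lebesgue h"
    define S where "S u = (SUP k. ennreal (2 powr (- \<delta> * real k)) * ?R (1 / 2 ^ k * u))" for u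
    have [measurable]: "S \<in> borel_measurable borel" unfolding S_def by measurable
    have le_S: "ennreal (2 powr (- \<delta> * real k)) * ?R (u / 2 ^ k) \<le> S u" for k u
      unfolding S_def by (rule SUP_upper2[of k]) auto
    have 1: "rearr lebesgue (dyadic_maximal h) u \<le> ennreal B * S u" if u: "0 < u" for u
    proof -
      have "ennreal (K / u) * (?R (u / 2 ^ Suc k) * ennreal (u / 2 ^ k))
        \<le> ennreal K * 2 * S u * ennreal ((2 powr - \<epsilon>) ^ k)" for k
      proof -
        \<comment> \<open>The factor \<open>2 powr (- Suc k)\<close> is shared out: the
          \<open>\<epsilon>\<close> part is summed over \<open>k\<close>, the
          \<open>\<delta>\<close> part is absorbed into \<open>S\<close>.\<close>
        have "2 powr (- \<epsilon> * real (Suc k)) * 2 powr (- \<delta> * real (Suc k)) = 2 powr (- real (Suc k))"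
          unfolding powr_add[symmetric] \<epsilon>_def by (simp add: algebra_simps)
        also have "\<dots> = 1 / (2 * 2 ^ k)"
          by (simp only: powr_minus_divide powr_realpow zero_less_numeral power_Suc)
        finally have "K / u * (u / 2 ^ k) = K * 2 * 2 powr (- \<epsilon> * real (Suc k)) * 2 powr (- \<delta> * real (Suc k))"
          using u by (simp only: mult.assoc) simp
        then have KU: "ennreal (K / u) * ennreal (u / 2 ^ k)
          = ennreal (K * 2 * 2 powr (- \<epsilon> * real (Suc k))) * ennreal (2 powr (- \<delta> * real (Suc k)))"
          using u \<open>0 < K\<close> by (subst (1 2) ennreal_mult[symmetric]) auto
        have "ennreal (K / u) * (?R (u / 2 ^ Suc k) * ennreal (u / 2 ^ k))
          = ennreal (K / u) * ennreal (u / 2 ^ k) * ?R (u / 2 ^ Suc k)"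
          by (simp only: mult.assoc mult.commute[of "?R (u / 2 ^ Suc k)"])
        also have "\<dots> = ennreal (K * 2 * 2 powr (- \<epsilon> * real (Suc k))) * (ennreal (2 powr (- \<delta> * real (Suc k))) * ?R (u / 2 ^ Suc k))"
          unfolding KU by (rule mult.assoc)
        also have "\<dots> \<le> ennreal (K * 2 * 2 powr (- \<epsilon> * real (Suc k))) * S u"
          by (intro mult_left_mono le_S) auto
        also have "\<dots> \<le> ennreal (K * 2 * (2 powr - \<epsilon>) ^ k) * S u"
        proof (intro mult_right_mono ennreal_leI mult_left_mono)
          have "2 powr (- \<epsilon> * real (Suc k)) \<le> 2 powr (- \<epsilon> * real k)"
            using d by (intro powr_mono mult_left_mono_neg) auto
          also have "\<dots> = (2 powr - \<epsilon>) ^ k"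
            by (simp only: powr_powr[symmetric]) (simp add: powr_realpow)
          finally show "2 powr (- \<epsilon> * real (Suc k)) \<le> (2 powr - \<epsilon>) ^ k" .
        qed (use \<open>0 < K\<close> in auto)
        also have "\<dots> = ennreal K * 2 * S u * ennreal ((2 powr - \<epsilon>) ^ k)"
          using \<open>0 < K\<close> by (simp add: ennreal_mult ac_simps)
        finally show ?thesis .
      qed
      note bound = this
      have "rearr lebesgue (dyadic_maximal h) u \<le> ?R u + ennreal (K / u) * (\<Sum>k. ?R (u / 2 ^ Suc k) * ennreal (u / 2 ^ k))"
        unfolding K_def
        by (rule order_trans[OF rearr_dyadic_maximal_le])
           (auto intro!: add_left_mono mult_left_mono nn_integral_gt_rearr_le u simp del: power_Suc)
      also have "\<dots> \<le> S u + (\<Sum>k. ennreal K * 2 * S u * ennreal ((2 powr - \<epsilon>) ^ k))"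
        unfolding ennreal_suminf_cmult[symmetric]
        by (intro add_mono suminf_le bound summableI) (use le_S[of 0 u] in simp)
      also have "\<dots> = ennreal B * S u"
      proof -
        have "ennreal B = 1 + ennreal K * 2 * ennreal (1 / (1 - 2 powr - \<epsilon>))"
          using small \<open>0 < K\<close> by (simp add: B_def ennreal_mult[symmetric] flip: ennreal_numeral ennreal_1 ennreal_plus)
        then show ?thesis
          using small unfolding ennreal_suminf_cmult
          by (subst suminf_geometric_ennreal) (auto simp: distrib_right mult.assoc mult.commute[of "S u"])
      qed
      finally show ?thesis .
    qed
    have "lorentz_fun p q (rearr lebesgue (dyadic_maximal h)) \<le> lorentz_fun p q (\<lambda>u. ennreal B * S u)"
      by (intro lorentz_fun_mono 1 q)
    also have "\<dots> = ennreal (B powr q) * lorentz_fun p q S"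
      using \<open>1 \<le> B\<close> by (simp add: lorentz_fun_cmult q)
    also have "lorentz_fun p q S \<le> (\<integral>\<^sup>+k. lorentz_fun p q (\<lambda>u. ennreal (2 powr (- \<delta> * real k)) * ?R (1 / 2 ^ k * u)) \<partial>count_space UNIV)"
      unfolding S_def by (rule lorentz_fun_SUP[OF q]) auto
    also have "\<dots> = (\<Sum>k. ennreal ((2 powr (- q * (\<delta> - 1/p))) ^ k) * lorentz_fun p q ?R)"
      unfolding nn_integral_count_space_nat
    proof (rule suminf_cong)
      fix k :: nat
      \<comment> \<open>Dilation by \<open>1 / 2 ^ k\<close> costs \<open>2 powr (k q / p)\<close>;
        the q-th power of the weight outweighs it because \<open>\<delta> > 1/p\<close>.\<close>
      have "ennreal ((2 powr (- \<delta> * real k)) powr q) * ennreal ((1 / 2 ^ k) powr (- q/p)) = ennreal ((2 powr (- q * (\<delta> - 1/p))) ^ k)"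
      proof -
        have "(1 / 2 ^ k) powr (- q/p) = (2 powr (- real k)) powr (- q/p)"
          by (simp add: powr_minus_divide powr_realpow)
        then have "(2 powr (- \<delta> * real k)) powr q * (1 / 2 ^ k) powr (- q/p) = 2 powr (- q * (\<delta> - 1/p) * real k)"
          by (simp add: powr_powr powr_add[symmetric] algebra_simps)
        also have "\<dots> = (2 powr (- q * (\<delta> - 1/p))) ^ k"
          by (simp only: powr_powr[symmetric]) (simp add: powr_realpow)
        finally show ?thesis by (simp add: ennreal_mult[symmetric])
      qed
      note factor = this
      have "lorentz_fun p q (\<lambda>u. ennreal (2 powr (- \<delta> * real k)) * ?R (1 / 2 ^ k * u))
        = ennreal_powr (ennreal (2 powr (- \<delta> * real k))) q * lorentz_fun p q (\<lambda>u. ?R (1 / 2 ^ k * u))"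
        by (rule lorentz_fun_cmult) (use q in auto)
      also have "lorentz_fun p q (\<lambda>u. ?R (1 / 2 ^ k * u)) = ennreal ((1 / 2 ^ k) powr (- q/p)) * lorentz_fun p q ?R"
        by (rule lorentz_fun_dilate) (use p q in auto)
      finally show "lorentz_fun p q (\<lambda>u. ennreal (2 powr (- \<delta> * real k)) * ?R (1 / 2 ^ k * u))
        = ennreal ((2 powr (- q * (\<delta> - 1/p))) ^ k) * lorentz_fun p q ?R"
        unfolding factor[symmetric] by (simp add: mult.assoc)
    qed
    also have "\<dots> = ennreal G * lorentz_fun p q ?R"
      using small by (simp only: ennreal_suminf_multc suminf_geometric_ennreal powr_ge_zero G_def)
    finally show ?thesis
      using \<open>0 < G\<close> by (simp add: ennreal_mult mult.assoc mult_left_mono)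
  qed
  then show ?thesis
    using \<open>1 \<le> B\<close> \<open>0 < G\<close> by (intro exI[of _ "B powr q * G"]) auto
qed

section \<open>The maximal operator on Morrey-type spaces\<close>

lemma lorentz_fun_max:
  assumes "0 < q" and [measurable]: "\<phi> \<in> borel_measurable borel" "\<psi> \<in> borel_measurable borel"
  shows "lorentz_fun p q (\<lambda>u. max (\<phi> u) (\<psi> u)) \<le> lorentz_fun p q \<phi> + lorentz_fun p q \<psi>"
proof -
  have "(\<lambda>u. max (\<phi> u) (\<psi> u)) = (\<lambda>u. SUP b\<in>UNIV. (if b then \<phi> else \<psi>) u)"
    by (auto simp: UNIV_bool sup_max max.commute)
  then show ?thesis
    using lorentz_fun_SUP[OF assms(1), of UNIV "\<lambda>b. if b then \<phi> else \<psi>" p]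
    by (simp add: nn_integral_count_space_finite UNIV_bool add.commute)
qed

lemma rearr_step_le:
  assumes [measurable]: "A \<in> sets M" and V: "emeasure M A = ennreal v"
  shows "rearr M (\<lambda>x. c * indicator A x) u \<le> c * indicator {..<v} u"
proof (cases "u < v")
  case True
  have "{x \<in> space M. c < c * indicator A x} = {}"
    by (auto split: split_indicator)
  then have "emeasure M {x \<in> space M. c < c * indicator A x} = 0"
    by (simp only: emeasure_empty)
  then show ?thesis using True by (simp add: rearr_le_iff)
next
  case False
  have "emeasure M {x \<in> space M. 0 < c * indicator A x} \<le> emeasure M A"
    by (intro emeasure_mono) (auto split: split_indicator_asm)
  also have "\<dots> \<le> ennreal u" using False V by (simp add: ennreal_leI)
  finally show ?thesis using False by (subst rearr_le_iff) simp_all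
qed

text \<open>The \<open>itself\<close> argument carries the dimension, which the generation does not
  determine.\<close>

definition dyadic_volume :: "'n itself \<Rightarrow> int \<Rightarrow> real" where
  "dyadic_volume _ j = 2 powr (- of_int j * real CARD('n))"

lemma dyadic_volume_pos [simp]: "0 < dyadic_volume TYPE('n) j"
  by (simp add: dyadic_volume_def)

lemma dyadic_volume_nonneg [simp]: "0 \<le> dyadic_volume TYPE('n) j"
  by (simp add: dyadic_volume_def)

lemma dyadic_volume_neq_0 [simp]: "dyadic_volume TYPE('n) j \<noteq> 0"
  by (simp add: dyadic_volume_def)

lemma emeasure_dyadic_cube_volume:
  "emeasure lebesgue (dyadic_cube j (k :: int^'n)) = ennreal (dyadic_volume TYPE('n) j)"
  by (simp add: emeasure_dyadic_cube dyadic_volume_def)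

lemma dyadic_avg_volume:
  "dyadic_avg (h :: real^'n \<Rightarrow> ennreal) j k
    = ennreal (1 / dyadic_volume TYPE('n) j) * (\<integral>\<^sup>+x\<in>dyadic_cube j k. h x \<partial>lebesgue)"
  by (simp add: dyadic_avg_def dyadic_volume_def powr_minus divide_inverse)

definition morrey_term :: "real \<Rightarrow> real \<Rightarrow> real \<Rightarrow> (real^'n \<Rightarrow> ennreal) \<Rightarrow> int \<Rightarrow> int^'n \<Rightarrow> ennreal" where
  "morrey_term p q t h j k = ennreal (dyadic_volume TYPE('n) j powr (1/t - 1/p)) *
     ennreal_powr (lorentz_fun p q (rearr lebesgue (\<lambda>x. h x * indicator (dyadic_cube j k) x))) (1/q)"

lemma lorentz_fun_morrey_term:
  fixes h :: "real^'n \<Rightarrow> ennreal"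
  assumes "0 < q"
  shows "lorentz_fun p q (rearr lebesgue (\<lambda>x. h x * indicator (dyadic_cube j k) x))
    = ennreal_powr (ennreal (dyadic_volume TYPE('n) j powr (1/p - 1/t)) * morrey_term p q t h j k) q"
proof -
  have "ennreal (dyadic_volume TYPE('n) j powr (1/p - 1/t)) * morrey_term p q t h j k
    = ennreal_powr (lorentz_fun p q (rearr lebesgue (\<lambda>x. h x * indicator (dyadic_cube j k) x))) (1/q)"
    unfolding morrey_term_def by (simp add: mult.assoc[symmetric] ennreal_mult[symmetric] powr_add[symmetric])
  then show ?thesis using assms by (simp add: ennreal_powr_powr)
qed

text \<open>Plays the part of Hoelder's inequality on a cube. The rearrangement of the restriction
  vanishes from the volume \<open>v\<close> on, so the integral is bounded by a sum over the levels
  \<open>v / 2 ^ k\<close>; the weak type bound at each level leaves a geometric series, convergent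
  since \<open>p > 1\<close>.\<close>

lemma dyadic_avg_le_morrey_term:
  fixes p q :: real
  assumes p: "1 < p" and q: "0 < q"
  shows "\<exists>C>0. \<forall>(h :: real^'n \<Rightarrow> ennreal) t j k. h \<in> borel_measurable lebesgue \<longrightarrow>
    dyadic_avg h j k \<le> ennreal (C * dyadic_volume TYPE('n) j powr (- 1/t)) * morrey_term p q t h j k"
proof -
  define c where "c = (2::real) powr (1/p + 1/q)"
  define x where "x = 2 powr (- (1 - 1/p))"
  have x: "0 \<le> x" "x < 1"
    unfolding x_def using powr_less_mono[of "- (1 - 1/p)" 0 "2::real"] p by simp_all
  \<comment> \<open>\<open>c\<close> is the constant of the weak type bound,
    \<open>2 powr (1/p)\<close> stems from the shift between level and measure, and \<open>x\<close>
    is the ratio of the series.\<close>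
  define C where "C = c * 2 powr (1/p) / (1 - x)"
  have "0 < C" using x by (simp add: C_def c_def)
  moreover have "dyadic_avg h j k \<le> ennreal (C * dyadic_volume TYPE('n) j powr (- 1/t)) * morrey_term p q t h j k"
    if [measurable]: "h \<in> borel_measurable lebesgue" for h :: "real^'n \<Rightarrow> ennreal" and t j k
  proof -
    define v where "v = dyadic_volume TYPE('n) j"
    have v: "0 < v" by (simp add: v_def)
    define g where "g x = h x * indicator (dyadic_cube j k) x" for x
    have [measurable]: "g \<in> borel_measurable lebesgue" unfolding g_def by measurable
    define L where "L = ennreal_powr (lorentz_fun p q (rearr lebesgue g)) (1/q)"
    have "emeasure lebesgue {x. 0 < g x} \<le> emeasure lebesgue (dyadic_cube j k)"
      by (intro emeasure_mono) (auto simp: g_def split: split_indicator_asm)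
    then have "rearr lebesgue g v \<le> 0"
      by (subst rearr_le_iff) (simp_all add: emeasure_dyadic_cube_volume v_def)
    then have "(\<integral>\<^sup>+x. g x \<partial>lebesgue) = (\<integral>\<^sup>+x. g x * indicator {x. rearr lebesgue g v < g x} x \<partial>lebesgue)"
      by (intro nn_integral_cong) (auto split: split_indicator)
    also have "\<dots> \<le> (\<Sum>k. rearr lebesgue g (v / 2 ^ Suc k) * ennreal (v / 2 ^ k))"
      by (rule nn_integral_gt_rearr_le) (use v in auto)
    also have "\<dots> \<le> (\<Sum>k. ennreal (c * 2 powr (1/p) * v powr (1 - 1/p)) * L * ennreal (x ^ k))"
    proof (intro suminf_le summableI)
      fix k
      have pull: "ennreal (c * a) * L * ennreal b = ennreal (c * (a * b)) * L" if "0 \<le> a" "0 \<le> b" for a b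
        using that by (simp add: c_def ennreal_mult mult.assoc mult.commute[of L])
      have xk: "x ^ k = 2 powr (- (1 - 1/p) * real k)"
        unfolding x_def by (simp only: powr_powr[symmetric]) (simp add: powr_realpow)
      have "v / 2 ^ Suc k = v * 2 powr (- real (Suc k))" "v / 2 ^ k = v * 2 powr (- real k)"
        by (simp_all only: powr_minus_divide powr_realpow zero_less_numeral times_divide_eq_right mult_1_right)
      then have "(v / 2 ^ Suc k) powr (- 1/p) * (v / 2 ^ k)
          = v powr (- 1/p) * 2 powr (real (Suc k) / p) * (v * 2 powr (- real k))"
        using v by (simp add: powr_mult powr_powr) (simp add: minus_divide_left add.commute)
      also have "\<dots> = (v powr (- 1/p) * v powr 1) * (2 powr (real (Suc k) / p) * 2 powr (- real k))"
        using v by simp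
      also have "\<dots> = v powr (1 - 1/p) * 2 powr (1/p + - (1 - 1/p) * real k)"
        unfolding powr_add[symmetric] by (simp add: algebra_simps add_divide_distrib)
      also have "\<dots> = 2 powr (1/p) * v powr (1 - 1/p) * x ^ k"
        unfolding xk by (simp only: powr_add mult.assoc mult.left_commute mult.commute)
      finally have e: "(v / 2 ^ Suc k) powr (- 1/p) * (v / 2 ^ k) = 2 powr (1/p) * v powr (1 - 1/p) * x ^ k" .
      have "rearr lebesgue g (v / 2 ^ Suc k) * ennreal (v / 2 ^ k)
         \<le> (ennreal (c * (v / 2 ^ Suc k) powr (- 1/p)) * L) * ennreal (v / 2 ^ k)"
        unfolding c_def L_def using p q v by (intro mult_right_mono antimono_le_lorentz_fun rearr_antimono) auto
      also have "\<dots> = ennreal (c * ((v / 2 ^ Suc k) powr (- 1/p) * (v / 2 ^ k))) * L"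
        using v by (intro pull) auto
      also have "\<dots> = ennreal (c * 2 powr (1/p) * v powr (1 - 1/p)) * L * ennreal (x ^ k)"
        unfolding e using v x(1) pull[of "2 powr (1/p) * v powr (1 - 1/p)" "x ^ k"] by (simp add: mult.assoc)
      finally show "rearr lebesgue g (v / 2 ^ Suc k) * ennreal (v / 2 ^ k)
         \<le> ennreal (c * 2 powr (1/p) * v powr (1 - 1/p)) * L * ennreal (x ^ k)" .
    qed
    also have "\<dots> = ennreal (c * 2 powr (1/p) * v powr (1 - 1/p)) * L * ennreal (1 / (1 - x))"
      using x by (simp only: ennreal_suminf_cmult suminf_geometric_ennreal)
    also have "\<dots> = ennreal (C * v powr (1 - 1/p)) * L"
      using x by (simp add: c_def C_def mult.assoc mult.commute[of L])
         (simp add: ennreal_mult[symmetric] mult.assoc[symmetric])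
    finally have "dyadic_avg h j k \<le> ennreal (1 / v) * (ennreal (C * v powr (1 - 1/p)) * L)"
      unfolding dyadic_avg_volume v_def[symmetric] g_def by (intro mult_left_mono) auto
    also have "\<dots> = ennreal (C * v powr (- 1/p)) * L"
    proof -
      have "1 / v * (C * v powr (1 - 1/p)) = C * v powr (- 1/p)"
        using v by (simp add: powr_diff powr_minus field_simps)
      then show ?thesis
        using v \<open>0 < C\<close> by (simp add: mult.assoc[symmetric] ennreal_mult[symmetric])
    qed
    also have "\<dots> = ennreal (C * v powr (- 1/t)) * (ennreal (v powr (1/t - 1/p)) * L)"
    proof -
      have "C * v powr (- 1/p) = (C * v powr (- 1/t)) * v powr (1/t - 1/p)"
        by (simp add: mult.assoc powr_add[symmetric])
      then show ?thesis
        using \<open>0 < C\<close> by (simp add: mult.assoc[symmetric] ennreal_mult[symmetric])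
    qed
    finally show ?thesis
      by (simp add: morrey_term_def L_def g_def[abs_def] v_def)
  qed
  ultimately show ?thesis by blast
qed

text \<open>Let \<open>Q\<close> be the cube of index \<open>k\<close>. A finer cube touching the
  one around \<open>x\<close> lies in \<open>Q\<close> or in a neighbour of \<open>Q\<close>, so its
  average sees only a restriction of \<open>h\<close>. A cube of the same or a coarser generation is
  a neighbour of an ancestor of \<open>Q\<close> or that ancestor, the same for all \<open>x\<close>
  in \<open>Q\<close>.\<close>

lemma dyadic_maximal_on_cube:
  fixes h :: "real^'n \<Rightarrow> ennreal"
  assumes x: "dyadic_index j x = k"
  shows "dyadic_maximal h x \<le>
    max (SUP e\<in>dyadic_offsets. dyadic_maximal (\<lambda>x. h x * indicator (dyadic_cube j (k + e)) x) x)
        (SUP i. SUP e\<in>dyadic_offsets. dyadic_avg h (j - int i) (dyadic_parent i k + e))"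
  unfolding dyadic_maximal_def[of h x]
proof (intro SUP_least)
  fix j' and e :: "int^'n" assume e: "e \<in> dyadic_offsets"
  show "dyadic_avg h j' (dyadic_index j' x + e) \<le>
    max (SUP e\<in>dyadic_offsets. dyadic_maximal (\<lambda>x. h x * indicator (dyadic_cube j (k + e)) x) x)
        (SUP i. SUP e\<in>dyadic_offsets. dyadic_avg h (j - int i) (dyadic_parent i k + e))"
  proof (cases "j' \<le> j")
    case True
    then have "j - int (nat (j - j')) = j'" by simp
    moreover from this have "dyadic_parent (nat (j - j')) k = dyadic_index j' x"
      using dyadic_index_parent[of j "nat (j - j')" x] x by simp
    ultimately show ?thesis
      using e by (intro max.coboundedI2 SUP_upper2[of "nat (j - j')"] SUP_upper2[of e]) auto
  next
    case False
    define y where "y = x + dyadic_shift j' e"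
    have y: "dyadic_index j' y = dyadic_index j' x + e"
      by (simp add: y_def dyadic_index_shift)
    define e' where "e' = dyadic_index j y - k"
    have "dyadic_index j' y - dyadic_index j' x \<in> dyadic_offsets"
      using e by (simp only: y add_diff_cancel_left')
    then have e': "e' \<in> dyadic_offsets"
      unfolding e'_def x[symmetric] using False by (rule_tac dyadic_index_offset_coarser) auto
    let ?g = "\<lambda>x. h x * indicator (dyadic_cube j (k + e')) x"
    have "dyadic_index j z = k + e'" if "dyadic_index j' z = dyadic_index j' y" for z
      using dyadic_index_coarser[OF that, of j] False by (simp add: e'_def)
    then have "(\<integral>\<^sup>+x\<in>dyadic_cube j' (dyadic_index j' y). h x \<partial>lebesgue)
        = (\<integral>\<^sup>+x\<in>dyadic_cube j' (dyadic_index j' y). ?g x \<partial>lebesgue)"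
      by (intro nn_integral_cong) (auto simp: mem_dyadic_cube split: split_indicator)
    then have "dyadic_avg h j' (dyadic_index j' x + e) = dyadic_avg ?g j' (dyadic_index j' x + e)"
      by (simp only: dyadic_avg_def y)
    also have "\<dots> \<le> dyadic_maximal ?g x"
      by (rule dyadic_avg_le_maximal) fact
    finally show ?thesis
      using e' by (intro max.coboundedI1 SUP_upper2[of e']) auto
  qed
qed

text \<open>An ancestor \<open>i\<close> generations up has \<open>2 ^ (i n)\<close> times the
  volume, and the power \<open>- 1/t\<close> of the volume in the bound for its average produces the
  weight. The neighbours of the cube itself are the terms with \<open>i = 0\<close>, so one supremum
  controls both the local and the constant part.\<close>

lemma morrey_term_dyadic_maximal:
  fixes p q :: real
  assumes p: "1 < p" and q: "0 < q"
  shows "\<exists>C>0. \<forall>(h :: real^'n \<Rightarrow> ennreal) t j k. h \<in> borel_measurable lebesgue \<longrightarrow>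
    morrey_term p q t (dyadic_maximal h) j k \<le> ennreal C *
      (SUP i. SUP e\<in>dyadic_offsets. ennreal (2 powr (- real i * real CARD('n) / t))
          * morrey_term p q t h (j - int i) (dyadic_parent i k + e))"
proof -
  obtain C1 where C1: "0 < C1" "\<And>h :: real^'n \<Rightarrow> ennreal. h \<in> borel_measurable lebesgue \<Longrightarrow>
    lorentz_fun p q (rearr lebesgue (dyadic_maximal h)) \<le> ennreal C1 * lorentz_fun p q (rearr lebesgue h)"
    using lorentz_dyadic_maximal[OF p q] by blast
  obtain C2 where C2: "0 < C2" "\<And>(h :: real^'n \<Rightarrow> ennreal) t j k. h \<in> borel_measurable lebesgue \<Longrightarrow>
    dyadic_avg h j k \<le> ennreal (C2 * dyadic_volume TYPE('n) j powr (- 1/t)) * morrey_term p q t h j k"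
    using dyadic_avg_le_morrey_term[OF p q] by blast
  define K where "K = real (card (dyadic_offsets :: (int^'n) set))"
  have K: "0 < K" by (simp add: K_def)
  \<comment> \<open>First summand, the local part: the level is halved for the maximum and divided
    by \<open>K\<close> for the supremum over neighbours, and \<open>K\<close> functionals are
    added. Second summand, the constant part: the halved level and the factor of the step
    function.\<close>
  define C3 where "C3 = (1/K/2) powr (-q/p) * C1 * K + (1/2) powr (- q/p) * (p/q) * C2 powr q"
  have C3: "0 < C3" unfolding C3_def using K C1(1) C2(1) p q by (intro add_pos_pos mult_pos_pos) auto
  have "morrey_term p q t (dyadic_maximal h) j k \<le> ennreal (C3 powr (1/q)) *
      (SUP i. SUP e\<in>dyadic_offsets. ennreal (2 powr (- real i * real CARD('n) / t))
          * morrey_term p q t h (j - int i) (dyadic_parent i k + e))" (is "_ \<le> _ * ?S")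
    if [measurable]: "h \<in> borel_measurable lebesgue" for h :: "real^'n \<Rightarrow> ennreal" and t j k
  proof -
    define S where "S = ?S"
    define v where "v = dyadic_volume TYPE('n) j"
    have v: "0 < v" by (simp add: v_def)
    have S: "ennreal (2 powr (- real i * real CARD('n) / t))
          * morrey_term p q t h (j - int i) (dyadic_parent i k + e) \<le> S" if "e \<in> dyadic_offsets" for i e
      unfolding S_def by (intro SUP_upper2[of i] SUP_upper2[of e] that order_refl) auto
    define A where "A = (SUP i. SUP e\<in>dyadic_offsets. dyadic_avg h (j - int i) (dyadic_parent i k + e))"
    have A: "A \<le> ennreal (C2 * v powr (- 1/t)) * S"
      unfolding A_def
    proof (intro SUP_least)
      fix i and e :: "int^'n" assume e: "e \<in> dyadic_offsets"
      have "dyadic_volume TYPE('n) (j - int i) powr (- 1/t) = v powr (- 1/t) * 2 powr (- real i * real CARD('n) / t)"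
        unfolding v_def dyadic_volume_def powr_powr powr_add[symmetric] by (simp add: field_simps add_divide_distrib diff_divide_distrib)
      then have "ennreal (C2 * dyadic_volume TYPE('n) (j - int i) powr (- 1/t)) * m
         = ennreal (C2 * v powr (- 1/t)) * (ennreal (2 powr (- real i * real CARD('n) / t)) * m)" for m
        using C2(1) by (simp add: ennreal_mult mult.assoc)
      then show "dyadic_avg h (j - int i) (dyadic_parent i k + e) \<le> ennreal (C2 * v powr (- 1/t)) * S"
        using C2(2)[of h "j - int i" "dyadic_parent i k + e" t] mult_left_mono[OF S[OF e, of i], of "ennreal (C2 * v powr (- 1/t))"]
        by simp
    qed
    define g where "g e = (\<lambda>x. h x * indicator (dyadic_cube j (k + e)) x)" for e
    have [measurable]: "g e \<in> borel_measurable lebesgue" for e unfolding g_def by measurable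
    \<comment> \<open>The supremum with the volume normalisation undone, raised to the power
      \<open>q\<close>; both parts are bounded by multiples of it.\<close>
    define T where "T = ennreal_powr (ennreal (v powr (1/p - 1/t)) * S) q"
    have g: "lorentz_fun p q (rearr lebesgue (g e)) \<le> T" if e: "e \<in> dyadic_offsets" for e
    proof -
      have "dyadic_parent 0 k = k" by (simp add: dyadic_parent_def)
      then have "morrey_term p q t h j (k + e) \<le> S" using S[OF e, of 0] by simp
      then show ?thesis
        unfolding g_def lorentz_fun_morrey_term[OF q, of p h j "k + e" t] T_def v_def
        using q by (intro ennreal_powr_mono mult_left_mono) auto
    qed
    let ?Q = "dyadic_cube j k" and ?O = "dyadic_offsets :: (int^'n) set"
    have [measurable]: "(\<lambda>x. SUP e\<in>?O. dyadic_maximal (g e) x) \<in> borel_measurable lebesgue"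
      by (intro borel_measurable_SUP) (auto intro: countable_finite)
    have "rearr lebesgue (\<lambda>x. dyadic_maximal h x * indicator ?Q x) u
      \<le> max (SUP e\<in>?O. rearr lebesgue (dyadic_maximal (g e)) (1/K/2 * u)) (A * indicator {..<v} (1/2 * u))"
      if u: "0 < u" for u
    proof -
      have "rearr lebesgue (\<lambda>x. dyadic_maximal h x * indicator ?Q x) u
         \<le> rearr lebesgue (\<lambda>x. max (SUP e\<in>?O. dyadic_maximal (g e) x) (A * indicator ?Q x)) u"
        by (rule rearr_mono)
           (use dyadic_maximal_on_cube[of j _ k h] in \<open>auto simp: A_def g_def mem_dyadic_cube split: split_indicator\<close>)
      also have "\<dots> \<le> max (rearr lebesgue (\<lambda>x. SUP e\<in>?O. dyadic_maximal (g e) x) (u / 2))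
          (rearr lebesgue (\<lambda>x. A * indicator ?Q x) (u / 2))"
        by (rule rearr_max_le) (use u in auto)
      also have "\<dots> \<le> max (SUP e\<in>?O. rearr lebesgue (dyadic_maximal (g e)) (u / 2 / card ?O)) (A * indicator {..<v} (u / 2))"
        by (intro max.mono rearr_SUP_le rearr_step_le)
           (use u in \<open>auto simp: emeasure_dyadic_cube_volume v_def\<close>)
      finally show ?thesis by (simp add: K_def mult.commute)
    qed
    then have "lorentz_fun p q (rearr lebesgue (\<lambda>x. dyadic_maximal h x * indicator ?Q x))
      \<le> lorentz_fun p q (\<lambda>u. max (SUP e\<in>?O. rearr lebesgue (dyadic_maximal (g e)) (1/K/2 * u)) (A * indicator {..<v} (1/2 * u)))"
      by (intro lorentz_fun_mono q)
    also have "\<dots> \<le> lorentz_fun p q (\<lambda>u. SUP e\<in>?O. rearr lebesgue (dyadic_maximal (g e)) (1/K/2 * u))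
       + lorentz_fun p q (\<lambda>u. A * indicator {..<v} (1/2 * u))"
    proof (rule lorentz_fun_max[OF q])
      show "(\<lambda>u. SUP e\<in>?O. rearr lebesgue (dyadic_maximal (g e)) (1/K/2 * u)) \<in> borel_measurable borel"
        by (intro borel_measurable_SUP) (auto intro: countable_finite)
    qed measurable
    also have "\<dots> \<le> ennreal ((1/K/2) powr (-q/p) * C1 * K) * T + ennreal ((1/2) powr (- q/p) * (p/q) * C2 powr q) * T"
    proof (rule add_mono)
      have "lorentz_fun p q (\<lambda>u. SUP e\<in>?O. rearr lebesgue (dyadic_maximal (g e)) (1/K/2 * u))
         \<le> (\<Sum>e\<in>?O. lorentz_fun p q (\<lambda>u. rearr lebesgue (dyadic_maximal (g e)) (1/K/2 * u)))"
        by (rule order_trans[OF lorentz_fun_SUP[OF q]])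
           (auto simp: nn_integral_count_space_finite intro: countable_finite)
      also have "\<dots> \<le> (\<Sum>e\<in>?O. ennreal ((1/K/2) powr (- q/p)) * (ennreal C1 * T))"
      proof (rule sum_mono)
        fix e assume e: "e \<in> ?O"
        have "lorentz_fun p q (\<lambda>u. rearr lebesgue (dyadic_maximal (g e)) (1/K/2 * u))
          = ennreal ((1/K/2) powr (- q/p)) * lorentz_fun p q (rearr lebesgue (dyadic_maximal (g e)))"
          by (rule lorentz_fun_dilate) (use K p q in auto)
        also have "\<dots> \<le> ennreal ((1/K/2) powr (- q/p)) * (ennreal C1 * T)"
          by (intro mult_left_mono order_trans[OF C1(2)] g e) auto
        finally show "lorentz_fun p q (\<lambda>u. rearr lebesgue (dyadic_maximal (g e)) (1/K/2 * u))
          \<le> ennreal ((1/K/2) powr (- q/p)) * (ennreal C1 * T)" .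
      qed
      also have "\<dots> = ennreal K * (ennreal ((1/K/2) powr (- q/p)) * (ennreal C1 * T))"
        by (simp add: K_def ennreal_of_nat_eq_real_of_nat)
      also have "\<dots> = ennreal (K * ((1/K/2) powr (- q/p) * C1)) * T"
        using C1(1) K by (simp only: ennreal_mult mult.assoc less_imp_le powr_ge_zero mult_nonneg_nonneg)
      finally show "lorentz_fun p q (\<lambda>u. SUP e\<in>?O. rearr lebesgue (dyadic_maximal (g e)) (1/K/2 * u))
        \<le> ennreal ((1/K/2) powr (-q/p) * C1 * K) * T" by (simp only: mult.commute)
    next
      have vT: "ennreal (v powr (q/p)) * ennreal_powr (ennreal (C2 * v powr (- 1/t)) * S) q = ennreal (C2 powr q) * T"
      proof -
        have "v powr (q/p) * (C2 * v powr (- 1/t)) powr q = C2 powr q * (v powr (1/p - 1/t)) powr q"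
        proof -
          have "v powr (q/p) * (C2 * v powr (- 1/t)) powr q = C2 powr q * (v powr (q/p) * v powr (- 1/t * q))"
            using v C2(1) by (simp add: powr_mult powr_powr)
          also have "\<dots> = C2 powr q * (v powr (1/p - 1/t)) powr q"
            unfolding powr_powr powr_add[symmetric] by (simp add: algebra_simps)
          finally show ?thesis .
        qed
        then show ?thesis
          using v C2(1) by (simp add: T_def ennreal_powr_mult[OF q] mult.assoc[symmetric] ennreal_mult[symmetric])
      qed
      have "lorentz_fun p q (\<lambda>u. A * indicator {..<v} (1/2 * u))
        = ennreal ((1/2) powr (- q/p)) * lorentz_fun p q (\<lambda>u. A * indicator {..<v} u)"
        by (rule lorentz_fun_dilate) (use p q in auto)
      also have "\<dots> \<le> ennreal ((1/2) powr (- q/p)) * (ennreal (p/q * v powr (q/p)) * ennreal_powr A q)"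
        by (intro mult_left_mono lorentz_fun_step) (use p q v in auto)
      also have "\<dots> \<le> ennreal ((1/2) powr (- q/p)) * (ennreal (p/q * v powr (q/p)) * ennreal_powr (ennreal (C2 * v powr (- 1/t)) * S) q)"
        using q by (intro mult_left_mono ennreal_powr_mono A) auto
      also have "\<dots> = ennreal ((1/2) powr (- q/p)) * (ennreal (p/q) * (ennreal (v powr (q/p)) * ennreal_powr (ennreal (C2 * v powr (- 1/t)) * S) q))"
        using p q by (subst ennreal_mult) (auto simp: mult.assoc)
      also have "\<dots> = ennreal ((1/2) powr (- q/p) * (p/q) * C2 powr q) * T"
      proof -
        have "0 \<le> p/q" using p q by simp
        then show ?thesis
          unfolding vT by (simp only: ennreal_mult mult.assoc powr_ge_zero mult_nonneg_nonneg)
      qed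
      finally show "lorentz_fun p q (\<lambda>u. A * indicator {..<v} (1/2 * u))
        \<le> ennreal ((1/2) powr (- q/p) * (p/q) * C2 powr q) * T" .
    qed
    also have "\<dots> = ennreal C3 * T"
      unfolding C3_def distrib_right[symmetric] using K C1(1) p q by (subst ennreal_plus[symmetric]) auto
    finally have "ennreal_powr (ennreal (v powr (1/p - 1/t)) * morrey_term p q t (dyadic_maximal h) j k) q
        \<le> ennreal_powr (ennreal (C3 powr (1/q)) * (ennreal (v powr (1/p - 1/t)) * S)) q"
      unfolding lorentz_fun_morrey_term[OF q, of p _ j k t] v_def[symmetric] T_def
      using q C3 by (simp add: ennreal_powr_mult powr_powr)
    then have "ennreal (v powr (1/p - 1/t)) * morrey_term p q t (dyadic_maximal h) j k
        \<le> ennreal (v powr (1/p - 1/t)) * (ennreal (C3 powr (1/q)) * S)"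
      using q by (subst (asm) ennreal_powr_le_iff) (auto simp: ennreal_powr_powr mult.left_commute)
    then show "morrey_term p q t (dyadic_maximal h) j k \<le> ennreal (C3 powr (1/q)) * ?S"
      using v by (subst (asm) ennreal_mult_le_mult_iff) (auto simp: ennreal_eq_0_iff S_def)
  qed
  then show ?thesis
    using C3 by (intro exI[of _ "C3 powr (1/q)"]) auto
qed

section \<open>Hedberg's inequality\<close>

text \<open>The generation satisfies
  \<open>2 powr (- j - 1) < norm (x - y) \<le> 2 powr (- j)\<close>. The upper bound makes the
  scaled coordinates, hence their floors, differ by at most one; the lower bound controls the
  kernel.\<close>

lemma near_dyadic_generation:
  fixes x y :: "real^'n"
  assumes "x \<noteq> y" "0 < \<beta>"
  shows "\<exists>j. dyadic_index j y - dyadic_index j x \<in> dyadic_offsets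
    \<and> 1 / norm (x - y) powr \<beta> \<le> 2 powr ((of_int j + 1) * \<beta>)"
proof -
  define d where "d = norm (x - y)"
  have d: "0 < d" using assms by (simp add: d_def)
  define j where "j = \<lfloor>- log 2 d\<rfloor>"
  have j: "of_int j \<le> - log 2 d" "- log 2 d < of_int j + 1"
    by (auto simp: j_def)
  have "2 powr (of_int j) \<le> 2 powr (- log 2 d)" using j by (intro powr_mono) auto
  then have jd: "2 powi j * d \<le> 1"
    using d by (simp add: powr_minus powr_real_of_int' field_simps)
  have "dyadic_index j y - dyadic_index j x \<in> dyadic_offsets"
    unfolding dyadic_offsets_def
  proof safe
    fix i
    have "\<bar>2 powi j * y $ i - 2 powi j * x $ i\<bar> = 2 powi j * \<bar>(x - y) $ i\<bar>"
      by (simp add: abs_mult abs_minus_commute flip: right_diff_distrib)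
    also have "\<dots> \<le> 2 powi j * d"
      unfolding d_def by (intro mult_left_mono component_le_norm_cart) auto
    also note jd
    finally show "\<bar>(dyadic_index j y - dyadic_index j x) $ i\<bar> \<le> 1"
      by (simp add: dyadic_index_def) linarith
  qed
  moreover have "1 / d powr \<beta> \<le> 2 powr ((of_int j + 1) * \<beta>)"
  proof -
    have "1 / d powr \<beta> = 2 powr (- log 2 d * \<beta>)"
      using d by (simp only: powr_powr[symmetric]) (simp add: powr_minus powr_divide inverse_eq_divide)
    also have "\<dots> \<le> 2 powr ((of_int j + 1) * \<beta>)"
      using j assms by (intro powr_mono mult_right_mono) auto
    finally show ?thesis .
  qed
  ultimately show ?thesis unfolding d_def by blast
qed

text \<open>At \<open>y = x\<close> division by zero makes the kernel \<open>0\<close>, in agreement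
  with \<open>fractional_integrand\<close>.\<close>

definition riesz_potential :: "real \<Rightarrow> (real^'n \<Rightarrow> ennreal) \<Rightarrow> real^'n \<Rightarrow> ennreal" where
  "riesz_potential \<alpha> h x =
     (\<integral>\<^sup>+y. h y * ennreal (1 / norm (x - y) powr (real CARD('n) - \<alpha>)) \<partial>lebesgue)"

lemma nn_integral_near_cubes_le:
  fixes h :: "real^'n \<Rightarrow> ennreal"
  assumes [measurable]: "h \<in> borel_measurable lebesgue"
    and B: "\<And>e. e \<in> dyadic_offsets \<Longrightarrow> dyadic_avg h j (dyadic_index j x + e) \<le> B"
  shows "(\<integral>\<^sup>+y\<in>{y. dyadic_index j y - dyadic_index j x \<in> dyadic_offsets}. h y \<partial>lebesgue)
    \<le> ennreal (card (dyadic_offsets :: (int^'n) set) * dyadic_volume TYPE('n) j) * B"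
proof -
  let ?O = "dyadic_offsets :: (int^'n) set" and ?v = "dyadic_volume TYPE('n) j"
  have "(\<integral>\<^sup>+y\<in>{y. dyadic_index j y - dyadic_index j x \<in> ?O}. h y \<partial>lebesgue)
    \<le> (\<integral>\<^sup>+y. (\<Sum>e\<in>?O. h y * indicator (dyadic_cube j (dyadic_index j x + e)) y) \<partial>lebesgue)"
  proof (rule nn_integral_mono)
    fix y
    show "h y * indicator {y. dyadic_index j y - dyadic_index j x \<in> ?O} y
      \<le> (\<Sum>e\<in>?O. h y * indicator (dyadic_cube j (dyadic_index j x + e)) y)"
    proof (cases "dyadic_index j y - dyadic_index j x \<in> ?O")
      case True
      then have "(\<Sum>e\<in>{dyadic_index j y - dyadic_index j x}. h y * indicator (dyadic_cube j (dyadic_index j x + e)) y)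
        \<le> (\<Sum>e\<in>?O. h y * indicator (dyadic_cube j (dyadic_index j x + e)) y)"
        by (intro sum_mono2) auto
      then show ?thesis using True by (simp add: mem_dyadic_cube)
    qed simp
  qed
  also have "\<dots> = (\<Sum>e\<in>?O. \<integral>\<^sup>+y\<in>dyadic_cube j (dyadic_index j x + e). h y \<partial>lebesgue)"
    by (rule nn_integral_sum) auto
  also have "\<dots> = (\<Sum>e\<in>?O. ennreal ?v * dyadic_avg h j (dyadic_index j x + e))"
    by (simp add: dyadic_avg_volume mult.assoc[symmetric] ennreal_mult[symmetric])
  also have "\<dots> \<le> (\<Sum>e\<in>?O. ennreal ?v * B)"
    by (intro sum_mono mult_left_mono B) auto
  also have "\<dots> = ennreal (card ?O * ?v) * B"
    by (simp add: ennreal_of_nat_eq_real_of_nat ennreal_mult mult.assoc)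
  finally show ?thesis .
qed

text \<open>At generation \<open>i\<close> the kernel times the volume of a cube has size
  \<open>2 powr (- i \<alpha>)\<close>. With \<open>M\<close> this is a convergent series over fine
  generations; over coarse ones the growth bound changes it to \<open>2 powr (i \<gamma>)\<close>,
  summable towards large cubes. The splitting generation stays free for a later
  optimisation.\<close>

lemma riesz_potential_split:
  fixes \<alpha> \<gamma> :: real
  assumes \<alpha>: "0 < \<alpha>" "\<alpha> < real CARD('n)" and \<gamma>: "0 < \<gamma>"
  shows "\<exists>C>0. \<forall>(h :: real^'n \<Rightarrow> ennreal) x M N. h \<in> borel_measurable lebesgue \<longrightarrow>
    (\<forall>j. \<forall>e\<in>dyadic_offsets. dyadic_avg h j (dyadic_index j x + e) \<le> M) \<longrightarrow>
    (\<forall>j. \<forall>e\<in>dyadic_offsets. dyadic_avg h j (dyadic_index j x + e) \<le> ennreal (2 powr (of_int j * (\<alpha> + \<gamma>))) * N) \<longrightarrow>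
    (\<forall>j. riesz_potential \<alpha> h x \<le> ennreal C * (ennreal (2 powr (- of_int j * \<alpha>)) * M + ennreal (2 powr (of_int j * \<gamma>)) * N))"
proof -
  define \<beta> where "\<beta> = real CARD('n) - \<alpha>"
  have \<beta>: "0 < \<beta>" using \<alpha> by (simp add: \<beta>_def)
  define K where "K = real (card (dyadic_offsets :: (int^'n) set))"
  have K: "0 < K" by (simp add: K_def)
  define a g where "a = 2 powr (- \<alpha>)" and "g = 2 powr (- \<gamma>)"
  have a: "0 < a" "a < 1" and g: "0 < g" "g < 1"
    unfolding a_def g_def using \<alpha> \<gamma> powr_less_mono[of "- \<alpha>" 0 "2::real"] powr_less_mono[of "- \<gamma>" 0 "2::real"] by auto
  define D where "D = 1 / (1 - a) + 1 / (1 - g)"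
  have D: "1 / (1 - a) \<le> D" "1 / (1 - g) \<le> D" using a g by (auto simp: D_def)
  have "0 < D" using a g by (auto simp: D_def add_pos_pos)
  define c where "c = 2 powr \<beta> * K"
  have c: "0 < c" using K by (simp add: c_def)
  have "riesz_potential \<alpha> h x \<le> ennreal (c * D) * (ennreal (2 powr (- of_int j0 * \<alpha>)) * M + ennreal (2 powr (of_int j0 * \<gamma>)) * N)"
    if [measurable]: "h \<in> borel_measurable lebesgue"
      and M: "\<And>j e. e \<in> dyadic_offsets \<Longrightarrow> dyadic_avg h j (dyadic_index j x + e) \<le> M"
      and N: "\<And>j e. e \<in> dyadic_offsets \<Longrightarrow> dyadic_avg h j (dyadic_index j x + e) \<le> ennreal (2 powr (of_int j * (\<alpha> + \<gamma>))) * N"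
    for h :: "real^'n \<Rightarrow> ennreal" and x M N j0
  proof -
    define P where "P j = {y. dyadic_index j y - dyadic_index j x \<in> dyadic_offsets}" for j
    have P [measurable]: "P j \<in> sets lebesgue" for j
    proof -
      have "{y \<in> space lebesgue. dyadic_index j y - dyadic_index j x \<in> dyadic_offsets} \<in> sets lebesgue"
        by (rule measurable_compose[OF measurable_dyadic_index_lebesgue, THEN measurable_sets_Collect, rotated]) auto
      then show ?thesis by (simp add: P_def)
    qed
    \<comment> \<open>\<open>F j\<close> majorises the integrand where the distance to
      \<open>x\<close> is about \<open>2 powr (- j)\<close>. The sets \<open>P j\<close> overlap,
      but for an upper bound it is enough that they cover all \<open>y\<close> other than
      \<open>x\<close>.\<close>
    define F where "F j y = h y * ennreal (2 powr ((of_int j + 1) * \<beta>)) * indicator (P j) y" for j y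
    have [measurable]: "F j \<in> borel_measurable lebesgue" for j
      unfolding F_def by measurable
    have F: "(\<integral>\<^sup>+y. F j y \<partial>lebesgue) \<le> ennreal (c * 2 powr (- of_int j * \<alpha>)) * B"
      if B: "\<And>e. e \<in> dyadic_offsets \<Longrightarrow> dyadic_avg h j (dyadic_index j x + e) \<le> B" for j B
    proof -
      have "(\<integral>\<^sup>+y. F j y \<partial>lebesgue) = ennreal (2 powr ((of_int j + 1) * \<beta>)) * (\<integral>\<^sup>+y\<in>P j. h y \<partial>lebesgue)"
        unfolding F_def by (subst nn_integral_cmult[symmetric]) (auto simp: ac_simps)
      also have "\<dots> \<le> ennreal (2 powr ((of_int j + 1) * \<beta>)) * (ennreal (K * dyadic_volume TYPE('n) j) * B)"
        unfolding P_def K_def by (intro mult_left_mono nn_integral_near_cubes_le B) auto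
      also have "\<dots> = ennreal (K * (2 powr ((of_int j + 1) * \<beta>) * dyadic_volume TYPE('n) j)) * B"
        using K by (simp add: mult.assoc[symmetric] ennreal_mult[symmetric]) (simp add: ac_simps)
      also have "2 powr ((of_int j + 1) * \<beta>) * dyadic_volume TYPE('n) j = 2 powr \<beta> * 2 powr (- of_int j * \<alpha>)"
        unfolding dyadic_volume_def powr_add[symmetric] by (simp add: \<beta>_def algebra_simps)
      finally show ?thesis by (simp add: c_def ac_simps)
    qed
    \<comment> \<open>\<open>j0 + i\<close> and \<open>j0 - 1 - i\<close> run through all
      generations, each once.\<close>
    have "riesz_potential \<alpha> h x \<le> (\<integral>\<^sup>+y. (\<Sum>i. F (j0 + int i) y) + (\<Sum>i. F (j0 - 1 - int i) y) \<partial>lebesgue)"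
      unfolding riesz_potential_def \<beta>_def[symmetric]
    proof (rule nn_integral_mono)
      fix y
      show "h y * ennreal (1 / norm (x - y) powr \<beta>) \<le> (\<Sum>i. F (j0 + int i) y) + (\<Sum>i. F (j0 - 1 - int i) y)"
      proof (cases "x = y")
        case False
        then obtain j where "y \<in> P j" "1 / norm (x - y) powr \<beta> \<le> 2 powr ((of_int j + 1) * \<beta>)"
          using near_dyadic_generation[OF False \<beta>] by (auto simp: P_def)
        then have Fj: "h y * ennreal (1 / norm (x - y) powr \<beta>) \<le> F j y"
          by (auto simp: F_def intro!: mult_left_mono ennreal_leI)
        have term_le: "s i \<le> (\<Sum>i. s i)" for s :: "nat \<Rightarrow> ennreal" and i
          using sum_le_suminf[of s "{i}"] by simp
        show ?thesis
        proof (cases "j0 \<le> j")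
          case True
          then show ?thesis
            using Fj term_le[of "\<lambda>i. F (j0 + int i) y" "nat (j - j0)"]
            by (intro add_increasing2) (auto intro: order_trans)
        next
          case False
          then have "F (j0 - 1 - int (nat (j0 - 1 - j))) y = F j y" by simp
          then show ?thesis
            using Fj term_le[of "\<lambda>i. F (j0 - 1 - int i) y" "nat (j0 - 1 - j)"]
            by (intro add_increasing) (auto intro: order_trans)
        qed
      qed simp
    qed
    also have "\<dots> = (\<Sum>i. \<integral>\<^sup>+y. F (j0 + int i) y \<partial>lebesgue) + (\<Sum>i. \<integral>\<^sup>+y. F (j0 - 1 - int i) y \<partial>lebesgue)"
      by (subst nn_integral_add) (auto simp: nn_integral_suminf)
    also have "\<dots> \<le> (\<Sum>i. ennreal (c * 2 powr (- of_int j0 * \<alpha>)) * M * ennreal (a ^ i))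
       + (\<Sum>i. ennreal (c * 2 powr (of_int j0 * \<gamma>)) * N * ennreal (g ^ i))"
    proof (intro add_mono suminf_le summableI)
      fix i :: nat
      have "2 powr (- of_int (j0 + int i) * \<alpha>) = 2 powr (- of_int j0 * \<alpha>) * (a ^ i)"
      proof -
        have "2 powr (- of_int (j0 + int i) * \<alpha>) = 2 powr (- of_int j0 * \<alpha> + (- \<alpha>) * real i)"
          by (simp add: algebra_simps)
        also have "\<dots> = 2 powr (- of_int j0 * \<alpha>) * (a ^ i)"
          unfolding powr_add powr_powr[symmetric] a_def by (simp add: powr_realpow)
        finally show ?thesis .
      qed
      then have "ennreal (c * 2 powr (- of_int (j0 + int i) * \<alpha>)) * M = ennreal (c * 2 powr (- of_int j0 * \<alpha>)) * M * ennreal (a ^ i)"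
        using a c by (simp add: ennreal_mult ac_simps)
      then show "(\<integral>\<^sup>+y. F (j0 + int i) y \<partial>lebesgue) \<le> ennreal (c * 2 powr (- of_int j0 * \<alpha>)) * M * ennreal (a ^ i)"
        using F[OF M, of "j0 + int i"] by simp
    next
      fix i :: nat
      define j where "j = j0 - 1 - int i"
      \<comment> \<open>The coarse part starts at \<open>j0 - 1\<close>; the resulting factor
        \<open>2 powr (- \<gamma>)\<close>, below \<open>1\<close>, is dropped.\<close>
      have "2 powr (- of_int j * \<alpha>) * 2 powr (of_int j * (\<alpha> + \<gamma>)) = 2 powr (of_int j0 * \<gamma> - \<gamma> + (- \<gamma>) * real i)"
        unfolding powr_add[symmetric] by (simp add: j_def algebra_simps)
      also have "\<dots> \<le> 2 powr (of_int j0 * \<gamma> + (- \<gamma>) * real i)"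
        using \<gamma> by (intro powr_mono) auto
      also have "\<dots> = 2 powr (of_int j0 * \<gamma>) * g ^ i"
        unfolding powr_add powr_powr[symmetric] g_def by (simp add: powr_realpow)
      finally have le: "2 powr (- of_int j * \<alpha>) * 2 powr (of_int j * (\<alpha> + \<gamma>)) \<le> 2 powr (of_int j0 * \<gamma>) * g ^ i" .
      have "(\<integral>\<^sup>+y. F j y \<partial>lebesgue) \<le> ennreal (c * 2 powr (- of_int j * \<alpha>)) * (ennreal (2 powr (of_int j * (\<alpha> + \<gamma>))) * N)"
        by (intro F N)
      also have "\<dots> = ennreal (c * (2 powr (- of_int j * \<alpha>) * 2 powr (of_int j * (\<alpha> + \<gamma>)))) * N"
        using c by (simp add: ennreal_mult[symmetric] mult.assoc[symmetric])
      also have "\<dots> \<le> ennreal (c * (2 powr (of_int j0 * \<gamma>) * g ^ i)) * N"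
        using c by (intro mult_right_mono ennreal_leI mult_left_mono le) auto
      also have "\<dots> = ennreal (c * 2 powr (of_int j0 * \<gamma>)) * N * ennreal (g ^ i)"
        using c g by (simp add: ennreal_mult ac_simps)
      finally show "(\<integral>\<^sup>+y. F (j0 - 1 - int i) y \<partial>lebesgue) \<le> ennreal (c * 2 powr (of_int j0 * \<gamma>)) * N * ennreal (g ^ i)"
        unfolding j_def .
    qed
    also have "\<dots> = ennreal (c * 2 powr (- of_int j0 * \<alpha>)) * M * ennreal (1 / (1 - a))
       + ennreal (c * 2 powr (of_int j0 * \<gamma>)) * N * ennreal (1 / (1 - g))"
      using a g by (simp only: ennreal_suminf_cmult suminf_geometric_ennreal less_imp_le)
    also have "\<dots> \<le> ennreal (c * 2 powr (- of_int j0 * \<alpha>)) * M * ennreal D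
       + ennreal (c * 2 powr (of_int j0 * \<gamma>)) * N * ennreal D"
      by (intro add_mono mult_left_mono ennreal_leI D) auto
    also have "\<dots> = ennreal (c * D) * (ennreal (2 powr (- of_int j0 * \<alpha>)) * M + ennreal (2 powr (of_int j0 * \<gamma>)) * N)"
      using c \<open>0 < D\<close> by (simp add: ennreal_mult distrib_left ac_simps)
    finally show ?thesis .
  qed
  then show ?thesis
    using c \<open>0 < D\<close> by (intro exI[of _ "c * D"]) auto
qed

text \<open>The two terms of the splitting balance when
  \<open>2 powr (j (\<alpha> + \<gamma>))\<close> is the ratio of the maximal function to
  \<open>N\<close>; there both equal the product of powers on the right.\<close>

lemma riesz_potential_hedberg:
  fixes \<alpha> \<gamma> :: real
  assumes \<alpha>: "0 < \<alpha>" "\<alpha> < real CARD('n)" and \<gamma>: "0 < \<gamma>"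
  shows "\<exists>C>0. \<forall>(h :: real^'n \<Rightarrow> ennreal) N x. h \<in> borel_measurable lebesgue \<longrightarrow> N < top \<longrightarrow>
    (\<forall>j k. dyadic_avg h j k \<le> ennreal (2 powr (of_int j * (\<alpha> + \<gamma>))) * N) \<longrightarrow>
    riesz_potential \<alpha> h x \<le> ennreal C * ennreal_powr N (\<alpha> / (\<alpha> + \<gamma>)) * ennreal_powr (dyadic_maximal h x) (\<gamma> / (\<alpha> + \<gamma>))"
proof -
  obtain C where C: "0 < C" "\<And>(h :: real^'n \<Rightarrow> ennreal) x M N j. h \<in> borel_measurable lebesgue \<Longrightarrow>
    (\<And>j e. e \<in> dyadic_offsets \<Longrightarrow> dyadic_avg h j (dyadic_index j x + e) \<le> M) \<Longrightarrow>
    (\<And>j e. e \<in> dyadic_offsets \<Longrightarrow> dyadic_avg h j (dyadic_index j x + e) \<le> ennreal (2 powr (of_int j * (\<alpha> + \<gamma>))) * N) \<Longrightarrow>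
    riesz_potential \<alpha> h x \<le> ennreal C * (ennreal (2 powr (- of_int j * \<alpha>)) * M + ennreal (2 powr (of_int j * \<gamma>)) * N)"
    using riesz_potential_split[OF assms] by metis
  define \<sigma> where "\<sigma> = \<alpha> + \<gamma>"
  have \<sigma>: "0 < \<sigma>" using \<alpha> \<gamma> by (simp add: \<sigma>_def)
  define C' where "C' = C * (2 powr \<alpha> + 1)"
  have "0 < C'" using C(1) by (simp add: C'_def add_pos_pos)
  have "riesz_potential \<alpha> h x \<le> ennreal C' * ennreal_powr N (\<alpha> / \<sigma>) * ennreal_powr (dyadic_maximal h x) (\<gamma> / \<sigma>)"
    if [measurable]: "h \<in> borel_measurable lebesgue" and N: "N < top"
      and avgN: "\<And>j k. dyadic_avg h j k \<le> ennreal (2 powr (of_int j * (\<alpha> + \<gamma>))) * N"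
    for h :: "real^'n \<Rightarrow> ennreal" and N x
  proof -
    let ?M = "dyadic_maximal h x"
    note avgM = dyadic_avg_le_maximal[of _ h _ x]
    \<comment> \<open>Balancing needs positive finite values. If either quantity is zero, the
      relevant averages vanish and the splitting with both bounds \<open>0\<close> gives potential
      zero; if only \<open>?M\<close> is infinite, so is the right side.\<close>
    consider "?M = 0 \<or> N = 0" | "?M = top" "N \<noteq> 0" | "?M \<noteq> 0" "?M \<noteq> top" "N \<noteq> 0" by blast
    then show ?thesis
    proof cases
      case 1
      have "dyadic_avg h j (dyadic_index j x + e) \<le> 0" if "e \<in> dyadic_offsets" for j e
        using 1 avgM[OF that, of j] avgN[of j "dyadic_index j x + e"] by auto
      then have "riesz_potential \<alpha> h x \<le> ennreal C * (ennreal (2 powr (- of_int 0 * \<alpha>)) * 0 + ennreal (2 powr (of_int 0 * \<gamma>)) * 0)"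
        by (intro C(2)) auto
      then show ?thesis by simp
    next
      case 2
      then have "ennreal C' * ennreal_powr N (\<alpha> / \<sigma>) \<noteq> 0" using \<open>0 < C'\<close> by (simp add: ennreal_eq_0_iff)
      then show ?thesis using 2 by (simp add: ennreal_mult_top)
    next
      case 3
      obtain m n where m: "?M = ennreal m" "0 < m" and n: "N = ennreal n" "0 < n"
        using 3 N by (cases ?M; cases N) (auto simp: less_le)
      \<comment> \<open>\<open>l\<close> is the exact balancing exponent and \<open>j\<close> its
        integer part. In the fine term \<open>l \<le> j + 1\<close> costs the factor
        \<open>2 powr \<alpha>\<close>; in the coarse term \<open>j \<le> l\<close> costs
        nothing.\<close>
      define l where "l = log 2 (m / n) / \<sigma>"
      define j where "j = \<lfloor>l\<rfloor>"
      have j: "of_int j \<le> l" "l \<le> of_int j + 1" by (auto simp: j_def)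
      have mn: "m / n = 2 powr (l * \<sigma>)"
        using m n \<sigma> by (simp add: l_def)
      then have m_eq: "m = n * 2 powr (l * \<sigma>)" using n by (simp add: field_simps)
      have R: "n powr (\<alpha> / \<sigma>) * m powr (\<gamma> / \<sigma>) = n * 2 powr (l * \<gamma>)"
      proof -
        have "n powr (\<alpha> / \<sigma>) * m powr (\<gamma> / \<sigma>) = n powr (\<alpha> / \<sigma> + \<gamma> / \<sigma>) * 2 powr (l * \<sigma> * (\<gamma> / \<sigma>))"
          unfolding m_eq using n by (simp add: powr_mult powr_powr powr_add)
        also have "\<alpha> / \<sigma> + \<gamma> / \<sigma> = 1" using \<sigma> by (simp add: \<sigma>_def add_divide_distrib[symmetric])
        finally show ?thesis using n \<sigma> by simp
      qed
      have "2 powr (- of_int j * \<alpha>) * m = n * 2 powr (- of_int j * \<alpha> + l * \<sigma>)"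
        unfolding m_eq powr_add by (rule mult.left_commute)
      also have "\<dots> \<le> n * 2 powr (\<alpha> + l * \<gamma>)"
      proof (intro mult_left_mono powr_mono)
        have "l * \<alpha> \<le> (of_int j + 1) * \<alpha>" using j \<alpha> by (intro mult_right_mono) auto
        then show "- of_int j * \<alpha> + l * \<sigma> \<le> \<alpha> + l * \<gamma>" by (simp add: \<sigma>_def algebra_simps)
      qed (use n in auto)
      finally have 1: "2 powr (- of_int j * \<alpha>) * m \<le> 2 powr \<alpha> * (n * 2 powr (l * \<gamma>))"
        by (simp add: powr_add ac_simps)
      have "2 powr (of_int j * \<gamma>) * n \<le> 2 powr (l * \<gamma>) * n"
        using j \<gamma> n by (intro mult_right_mono powr_mono) auto
      then have "2 powr (- of_int j * \<alpha>) * m + 2 powr (of_int j * \<gamma>) * n \<le> (2 powr \<alpha> + 1) * (n * 2 powr (l * \<gamma>))"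
        using 1 by (simp add: algebra_simps)
      then have 2: "C * (2 powr (- of_int j * \<alpha>) * m + 2 powr (of_int j * \<gamma>) * n) \<le> C' * (n powr (\<alpha> / \<sigma>) * m powr (\<gamma> / \<sigma>))"
        unfolding R C'_def mult.assoc using C(1) by (intro mult_left_mono) auto
      have "riesz_potential \<alpha> h x \<le> ennreal C * (ennreal (2 powr (- of_int j * \<alpha>)) * ?M + ennreal (2 powr (of_int j * \<gamma>)) * N)"
        by (intro C(2) avgM avgN) auto
      also have "\<dots> = ennreal (C * (2 powr (- of_int j * \<alpha>) * m + 2 powr (of_int j * \<gamma>) * n))"
        using m n C(1) by (simp add: ennreal_mult)
      also have "\<dots> \<le> ennreal (C' * (n powr (\<alpha> / \<sigma>) * m powr (\<gamma> / \<sigma>)))"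
        by (intro ennreal_leI 2)
      also have "\<dots> = ennreal C' * ennreal_powr N (\<alpha> / \<sigma>) * ennreal_powr ?M (\<gamma> / \<sigma>)"
        using m n \<open>0 < C'\<close> by (simp add: ennreal_mult mult.assoc)
      finally show ?thesis .
    qed
  qed
  then show ?thesis
    using \<open>0 < C'\<close> unfolding \<sigma>_def by blast
qed

section \<open>Bourgain-Morrey-Lorentz norms\<close>

text \<open>Pairs of indices replace the set of cubes, so that shifting the generation or adding an
  offset is a bijection of the index type.\<close>

definition morrey_norm :: "real \<Rightarrow> real \<Rightarrow> real \<Rightarrow> ennreal \<Rightarrow> (real^'n \<Rightarrow> ennreal) \<Rightarrow> ennreal" where
  "morrey_norm p q t r h =
     (if r = \<infinity> then (SUP j. SUP k. morrey_term p q t h j k)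
      else ennreal_powr (\<integral>\<^sup>+j. \<integral>\<^sup>+k. ennreal_powr (morrey_term p q t h j k) (enn2real r)
             \<partial>count_space UNIV \<partial>count_space UNIV) (1 / enn2real r))"

lemma infsum_ennreal_eq_nn_integral:
  fixes g :: "'a \<Rightarrow> ennreal"
  assumes "countable A" "infinite A"
  shows "infsum g A = (\<integral>\<^sup>+x. g x \<partial>count_space A)"
proof -
  have bij: "bij_betw (from_nat_into A) UNIV A"
    using assms by (rule bij_betw_from_nat_into)
  have "infsum g A = infsum (\<lambda>n. g (from_nat_into A n)) UNIV"
    by (rule infsum_reindex_bij_betw[OF bij, symmetric])
  also have "\<dots> = (\<Sum>n. g (from_nat_into A n))"
    by (intro sums_unique has_sum_imp_sums has_sum_infsum nonneg_summable_on_complete) simp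
  also have "\<dots> = (\<integral>\<^sup>+x. g x \<partial>count_space A)"
    unfolding nn_integral_count_space_nat[symmetric] by (rule nn_integral_bij_count_space[OF bij])
  finally show ?thesis .
qed

text \<open>Volume determines the generation, and then any point of the cube determines the index.
  Thus a sum over the set of cubes counts each pair of indices once.\<close>

lemma inj_dyadic_cube: "inj (\<lambda>(j, k :: int^'n). dyadic_cube j k)"
proof (rule injI, safe)
  fix j j' and k k' :: "int^'n"
  assume eq: "dyadic_cube j k = dyadic_cube j' k'"
  then have "dyadic_volume TYPE('n) j = dyadic_volume TYPE('n) j'"
    using emeasure_dyadic_cube_volume[of j k] emeasure_dyadic_cube_volume[of j' k'] by simp
  then show j: "j = j'"
    by (simp add: dyadic_volume_def powr_inj)
  obtain x where "dyadic_index j x = k" using ex_dyadic_index by blast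
  then show "k = k'" using eq j by (metis mem_dyadic_cube)
qed

lemma lorentz_norm_eq:
  "lorentz_norm p q f = ennreal_powr (lorentz_fun p q (rearr lebesgue (\<lambda>x. ennreal (norm (f x))))) (1/q)"
proof -
  have "decreasing_rearrangement f = rearr lebesgue (\<lambda>x. ennreal (norm (f x)))"
    unfolding decreasing_rearrangement_def[abs_def] rearr_def[abs_def] distribution_function_def
    by (intro ext INF_cong) (auto simp: ennreal_less_iff)
  then show ?thesis
    by (simp add: lorentz_norm_def lorentz_fun_def)
qed

lemma lorentz_norm_on_dyadic_cube:
  fixes f :: "real^'n \<Rightarrow> complex"
  shows "ennreal (measure lebesgue (dyadic_cube j k) powr (1/t - 1/p)) * lorentz_norm_on p q (dyadic_cube j k) f
    = morrey_term p q t (\<lambda>x. ennreal (norm (f x))) j k"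
proof -
  have "(\<lambda>x. ennreal (norm (indicator (dyadic_cube j k) x *\<^sub>R f x))) = (\<lambda>x. ennreal (norm (f x)) * indicator (dyadic_cube j k) x)"
    by (auto split: split_indicator)
  moreover have "measure lebesgue (dyadic_cube j k) = dyadic_volume TYPE('n) j"
    by (simp add: measure_def emeasure_dyadic_cube_volume)
  ultimately show ?thesis
    by (simp add: lorentz_norm_on_def lorentz_norm_eq morrey_term_def)
qed

lemma bourgain_morrey_lorentz_norm_eq:
  fixes f :: "real^'n \<Rightarrow> complex"
  assumes r: "r = \<infinity> \<or> 0 < enn2real r"
  shows "bourgain_morrey_lorentz_norm p q t r f = morrey_norm p q t r (\<lambda>x. ennreal (norm (f x)))"
proof -
  have cubes: "(dyadic_cubes :: (real^'n) set set) = range (\<lambda>(j, k). dyadic_cube j k)"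
    by (auto simp: dyadic_cubes_def)
  show ?thesis
  proof (cases "r = \<infinity>")
    case True
    have "(SUP Q\<in>dyadic_cubes. ennreal (measure lebesgue Q powr (1/t - 1/p)) * lorentz_norm_on p q Q f)
      = (SUP (j, k). morrey_term p q t (\<lambda>x. ennreal (norm (f x))) j k)"
      unfolding cubes image_image
      by (intro SUP_cong refl) (simp only: split_paired_all prod.case lorentz_norm_on_dyadic_cube)
    also have "\<dots> = (SUP j. SUP k. morrey_term p q t (\<lambda>x. ennreal (norm (f x))) j k)"
      by (intro antisym SUP_least) (auto intro!: SUP_upper2[of "(_, _)"] intro: SUP_upper2)
    finally show ?thesis
      using True by (simp add: bourgain_morrey_lorentz_norm_def morrey_norm_def)
  next
    case False
    define s where "s = enn2real r"
    have s: "0 < s" using r False by (simp add: s_def)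
    define W where "W = (\<lambda>(j, k). ennreal_powr (morrey_term p q t (\<lambda>x. ennreal (norm (f x))) j k) s)"
    have W: "ennreal (measure lebesgue (dyadic_cube j k) powr (s/t - s/p)) * ennreal_powr (lorentz_norm_on p q (dyadic_cube j k) f) s
      = W (j, k)" for j and k :: "int^'n"
      using s unfolding W_def lorentz_norm_on_dyadic_cube[symmetric]
      by (simp add: ennreal_powr_mult powr_powr left_diff_distrib)
    have inf: "infinite (UNIV :: (int \<times> (int^'n)) set)"
      by (simp add: finite_prod)
    have "(\<Sum>\<^sub>\<infinity>Q\<in>dyadic_cubes. ennreal (measure lebesgue Q powr (s/t - s/p)) * ennreal_powr (lorentz_norm_on p q Q f) s)
      = infsum W UNIV"
      unfolding cubes infsum_reindex[OF inj_dyadic_cube]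
      by (intro infsum_cong) (simp only: o_def split_paired_all prod.case W)
    also have "\<dots> = (\<integral>\<^sup>+x. W x \<partial>count_space UNIV)"
      by (intro infsum_ennreal_eq_nn_integral inf) auto
    also have "\<dots> = (\<integral>\<^sup>+j. \<integral>\<^sup>+k. W (j, k) \<partial>count_space UNIV \<partial>count_space UNIV)"
      by (rule nn_integral_fst_count_space[symmetric])
    finally show ?thesis
      using False by (simp add: bourgain_morrey_lorentz_norm_def morrey_norm_def s_def W_def)
  qed
qed

lemma morrey_term_le_norm:
  assumes r: "r = \<infinity> \<or> 0 < enn2real r"
  shows "morrey_term p q t h j k \<le> morrey_norm p q t r h"
proof (cases "r = \<infinity>")
  case True
  then show ?thesis
    by (auto simp: morrey_norm_def intro!: SUP_upper2[of j] SUP_upper2[of k])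
next
  case False
  then have "ennreal_powr (morrey_term p q t h j k) (enn2real r) \<le>
     (\<integral>\<^sup>+j. \<integral>\<^sup>+k. ennreal_powr (morrey_term p q t h j k) (enn2real r) \<partial>count_space UNIV \<partial>count_space UNIV)"
    by (intro order_trans[OF nn_integral_ge_point[of k UNIV "\<lambda>k. ennreal_powr (morrey_term p q t h j k) (enn2real r)"]]
        nn_integral_ge_point[of j UNIV "\<lambda>j. \<integral>\<^sup>+k. ennreal_powr (morrey_term p q t h j k) (enn2real r) \<partial>count_space UNIV"]) auto
  then show ?thesis
    using r False by (simp add: morrey_norm_def ennreal_powr_le_iff)
qed

text \<open>As \<open>r1 = \<theta> * r2\<close> for finite exponents, the power \<open>r2\<close>
  of a \<open>\<theta>\<close>-th power is the power \<open>r1\<close>, and the outer exponent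
  \<open>1 / r2\<close> is \<open>\<theta> / r1\<close>. For infinite exponents monotonicity
  suffices.\<close>

lemma morrey_norm_powr_le:
  assumes \<theta>: "0 < \<theta>"
    and r: "r1 = \<infinity> \<and> r2 = \<infinity> \<or> r1 \<noteq> \<infinity> \<and> r2 \<noteq> \<infinity> \<and> 0 < enn2real r2 \<and> enn2real r1 = \<theta> * enn2real r2"
    and le: "\<And>j k. morrey_term p2 q2 t2 h j k \<le> c * ennreal_powr (morrey_term p1 q1 t1 g j k) \<theta>"
  shows "morrey_norm p2 q2 t2 r2 h \<le> c * ennreal_powr (morrey_norm p1 q1 t1 r1 g) \<theta>"
  using r
proof
  assume r: "r1 = \<infinity> \<and> r2 = \<infinity>"
  then have "morrey_term p2 q2 t2 h j k \<le> c * ennreal_powr (morrey_norm p1 q1 t1 r1 g) \<theta>" for j k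
    using \<theta> by (intro order_trans[OF le] mult_left_mono ennreal_powr_mono morrey_term_le_norm) auto
  then show ?thesis
    using r by (auto simp: morrey_norm_def[of p2] intro!: SUP_least)
next
  assume r: "r1 \<noteq> \<infinity> \<and> r2 \<noteq> \<infinity> \<and> 0 < enn2real r2 \<and> enn2real r1 = \<theta> * enn2real r2"
  define s where "s = enn2real r2"
  have s: "0 < s" using r by (simp add: s_def)
  have "(\<integral>\<^sup>+j. \<integral>\<^sup>+k. ennreal_powr (morrey_term p2 q2 t2 h j k) s \<partial>count_space UNIV \<partial>count_space UNIV)
    \<le> (\<integral>\<^sup>+j. \<integral>\<^sup>+k. ennreal_powr c s * ennreal_powr (morrey_term p1 q1 t1 g j k) (\<theta> * s) \<partial>count_space UNIV \<partial>count_space UNIV)"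
    unfolding ennreal_powr_powr[symmetric] ennreal_powr_mult[OF s, symmetric]
    using s by (intro nn_integral_mono ennreal_powr_mono le) auto
  also have "\<dots> = ennreal_powr c s * (\<integral>\<^sup>+j. \<integral>\<^sup>+k. ennreal_powr (morrey_term p1 q1 t1 g j k) (\<theta> * s) \<partial>count_space UNIV \<partial>count_space UNIV)"
    by (simp add: nn_integral_cmult)
  finally have "morrey_norm p2 q2 t2 r2 h \<le> ennreal_powr (ennreal_powr c s * (\<integral>\<^sup>+j. \<integral>\<^sup>+k. ennreal_powr (morrey_term p1 q1 t1 g j k) (\<theta> * s) \<partial>count_space UNIV \<partial>count_space UNIV)) (1/s)"
    using r s by (simp add: morrey_norm_def s_def ennreal_powr_mono)
  also have "\<dots> = c * ennreal_powr (morrey_norm p1 q1 t1 r1 g) \<theta>"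
    using r s \<theta> by (simp add: morrey_norm_def s_def ennreal_powr_mult ennreal_powr_powr)
  finally show ?thesis .
qed

text \<open>Each cube of generation \<open>j - i\<close> has \<open>2 ^ (i n)\<close> descendants of generation \<open>j\<close>.\<close>

lemma nn_integral_dyadic_ancestors:
  fixes W :: "int \<Rightarrow> int^'n \<Rightarrow> ennreal"
  shows "(\<integral>\<^sup>+j. \<integral>\<^sup>+k. W (j - int i) (dyadic_parent i k + e) \<partial>count_space UNIV \<partial>count_space UNIV)
    = ennreal (2 powr (real i * real CARD('n))) * (\<integral>\<^sup>+j. \<integral>\<^sup>+k. W j k \<partial>count_space UNIV \<partial>count_space UNIV)"
proof -
  \<comment> \<open>The sums over generations \<open>j\<close> and \<open>j - i\<close> become
    integrals of the same step function, so counting descendants reduces to a ratio of cube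
    volumes.\<close>
  have gen: "(\<integral>\<^sup>+k. \<Psi> k \<partial>count_space UNIV) = ennreal (1 / dyadic_volume TYPE('n) j) * (\<integral>\<^sup>+x. \<Psi> (dyadic_index j x) \<partial>lebesgue)"
    for \<Psi> :: "int^'n \<Rightarrow> ennreal" and j
  proof -
    have "(\<integral>\<^sup>+x. \<Psi> (dyadic_index j x) \<partial>lebesgue) = ennreal (dyadic_volume TYPE('n) j) * (\<integral>\<^sup>+k. \<Psi> k \<partial>count_space UNIV)"
      by (simp add: nn_integral_dyadic_index dyadic_volume_def)
    then show ?thesis
      by (simp add: mult.assoc[symmetric] ennreal_mult[symmetric])
  qed
  have vol: "1 / dyadic_volume TYPE('n) j = 2 powr (real i * real CARD('n)) * (1 / dyadic_volume TYPE('n) (j - int i))" for j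
    by (simp add: dyadic_volume_def powr_minus_divide powr_add[symmetric] algebra_simps)
      (simp add: divide_simps powr_add[symmetric])
  have "(\<integral>\<^sup>+k. W (j - int i) (dyadic_parent i k + e) \<partial>count_space UNIV)
    = ennreal (2 powr (real i * real CARD('n))) * (\<integral>\<^sup>+k. W (j - int i) k \<partial>count_space UNIV)" for j
  proof -
    have "(\<integral>\<^sup>+k. W (j - int i) (dyadic_parent i k + e) \<partial>count_space UNIV)
      = ennreal (1 / dyadic_volume TYPE('n) j) * (\<integral>\<^sup>+x. W (j - int i) (dyadic_index (j - int i) x + e) \<partial>lebesgue)"
      by (subst gen[of _ j]) (simp add: dyadic_index_parent)
    also have "\<dots> = ennreal (2 powr (real i * real CARD('n))) * (\<integral>\<^sup>+k. W (j - int i) (k + e) \<partial>count_space UNIV)"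
      unfolding vol[of j] gen[of "\<lambda>k. W (j - int i) (k + e)" "j - int i"] by (simp only: ennreal_mult mult.assoc powr_ge_zero zero_le_divide_1_iff dyadic_volume_nonneg)
    also have "(\<integral>\<^sup>+k. W (j - int i) (k + e) \<partial>count_space UNIV) = (\<integral>\<^sup>+k. W (j - int i) k \<partial>count_space UNIV)"
      by (rule nn_integral_bij_count_space) (simp add: bij_plus_right)
    finally show ?thesis .
  qed
  then have "(\<integral>\<^sup>+j. \<integral>\<^sup>+k. W (j - int i) (dyadic_parent i k + e) \<partial>count_space UNIV \<partial>count_space UNIV)
    = ennreal (2 powr (real i * real CARD('n))) * (\<integral>\<^sup>+j. \<integral>\<^sup>+k. W (j - int i) k \<partial>count_space UNIV \<partial>count_space UNIV)"
    by (simp add: nn_integral_cmult)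
  also have "(\<integral>\<^sup>+j. \<integral>\<^sup>+k. W (j - int i) k \<partial>count_space UNIV \<partial>count_space UNIV) = (\<integral>\<^sup>+j. \<integral>\<^sup>+k. W j k \<partial>count_space UNIV \<partial>count_space UNIV)"
    by (rule nn_integral_bij_count_space[where f = "\<lambda>j. \<integral>\<^sup>+k. W j k \<partial>count_space UNIV"])
       (auto intro!: bij_betwI[where g = "\<lambda>j. j + int i"])
  finally show ?thesis .
qed

text \<open>At the power \<open>s\<close> the weight is \<open>2 powr (- i n s / t)\<close>, and
  \<open>2 ^ (i n)\<close> cubes share an ancestor. The product is the \<open>i\<close>-th power of
  \<open>2 powr (n (1 - s / t))\<close>, which is below \<open>1\<close> because
  \<open>t < s\<close>.\<close>

lemma nn_integral_SUP_ancestors_le: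
  fixes w :: "int \<Rightarrow> int^'n \<Rightarrow> ennreal"
  assumes t: "0 < t" "t < s"
  shows "(\<integral>\<^sup>+j. \<integral>\<^sup>+k. ennreal_powr (SUP i. SUP e\<in>dyadic_offsets. ennreal (2 powr (- real i * real CARD('n) / t))
          * w (j - int i) (dyadic_parent i k + e)) s \<partial>count_space UNIV \<partial>count_space UNIV)
    \<le> ennreal (card (dyadic_offsets :: (int^'n) set) / (1 - 2 powr (real CARD('n) * (1 - s / t))))
       * (\<integral>\<^sup>+j. \<integral>\<^sup>+k. ennreal_powr (w j k) s \<partial>count_space UNIV \<partial>count_space UNIV)"
proof -
  let ?O = "dyadic_offsets :: (int^'n) set" and ?n = "real CARD('n)"
  have s: "0 < s" using t by simp
  define x where "x = 2 powr (?n * (1 - s / t))"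
  have "?n * (1 - s / t) < 0" using t by (intro mult_pos_neg) auto
  then have x: "0 \<le> x" "x < 1" unfolding x_def using powr_less_mono[of "?n * (1 - s / t)" 0 "2::real"] by auto
  define T where "T = (\<integral>\<^sup>+j. \<integral>\<^sup>+k. ennreal_powr (w j k) s \<partial>count_space UNIV \<partial>count_space UNIV)"
  define W where "W i j k = ennreal (2 powr (- real i * ?n / t * s)) * ennreal_powr (w j k) s" for i j k
  have "(\<integral>\<^sup>+j. \<integral>\<^sup>+k. ennreal_powr (SUP i. SUP e\<in>?O. ennreal (2 powr (- real i * ?n / t))
          * w (j - int i) (dyadic_parent i k + e)) s \<partial>count_space UNIV \<partial>count_space UNIV)
    \<le> (\<integral>\<^sup>+j. \<integral>\<^sup>+k. (\<Sum>i. \<Sum>e\<in>?O. W i (j - int i) (dyadic_parent i k + e)) \<partial>count_space UNIV \<partial>count_space UNIV)"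
  proof (intro nn_integral_mono)
    fix j and k :: "int^'n"
    have "ennreal_powr (SUP i. SUP e\<in>?O. ennreal (2 powr (- real i * ?n / t)) * w (j - int i) (dyadic_parent i k + e)) s
      \<le> (SUP i. SUP e\<in>?O. ennreal_powr (ennreal (2 powr (- real i * ?n / t)) * w (j - int i) (dyadic_parent i k + e)) s)"
      by (intro order_trans[OF ennreal_powr_SUP_le[OF s]] SUP_mono' ennreal_powr_SUP_le[OF s])
    also have "\<dots> = (SUP i. SUP e\<in>?O. W i (j - int i) (dyadic_parent i k + e))"
      using s by (simp add: W_def ennreal_powr_mult powr_powr)
    also have "\<dots> \<le> (SUP i. \<Sum>e\<in>?O. W i (j - int i) (dyadic_parent i k + e))"
      by (intro SUP_mono' order_trans[OF SUP_le_nn_integral_count_space]) (simp add: nn_integral_count_space_finite)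
    also have "\<dots> \<le> (\<Sum>i. \<Sum>e\<in>?O. W i (j - int i) (dyadic_parent i k + e))"
      unfolding nn_integral_count_space_nat[symmetric] by (rule SUP_le_nn_integral_count_space)
    finally show "ennreal_powr (SUP i. SUP e\<in>?O. ennreal (2 powr (- real i * ?n / t)) * w (j - int i) (dyadic_parent i k + e)) s
      \<le> (\<Sum>i. \<Sum>e\<in>?O. W i (j - int i) (dyadic_parent i k + e))" .
  qed
  also have "\<dots> = (\<Sum>i. \<Sum>e\<in>?O. \<integral>\<^sup>+j. \<integral>\<^sup>+k. W i (j - int i) (dyadic_parent i k + e) \<partial>count_space UNIV \<partial>count_space UNIV)"
    by (simp add: nn_integral_suminf nn_integral_sum)
  also have "\<dots> = (\<Sum>i. of_nat (card ?O) * T * ennreal (x ^ i))"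
  proof (rule suminf_cong)
    fix i
    have "2 powr (real i * ?n) * 2 powr (- real i * ?n / t * s) = 2 powr (?n * (1 - s / t) * real i)"
      unfolding powr_add[symmetric] by (simp add: algebra_simps)
    also have "\<dots> = x ^ i"
      unfolding x_def by (simp only: powr_powr[symmetric]) (simp add: powr_realpow)
    finally have xi: "2 powr (real i * ?n) * 2 powr (- real i * ?n / t * s) = x ^ i" .
    have "(\<integral>\<^sup>+j. \<integral>\<^sup>+k. W i (j - int i) (dyadic_parent i k + e) \<partial>count_space UNIV \<partial>count_space UNIV) = ennreal (x ^ i) * T" for e
      unfolding nn_integral_dyadic_ancestors[of "W i"] xi[symmetric]
      by (simp add: W_def[abs_def] T_def nn_integral_cmult ennreal_mult mult.assoc)
    then show "(\<Sum>e\<in>?O. \<integral>\<^sup>+j. \<integral>\<^sup>+k. W i (j - int i) (dyadic_parent i k + e) \<partial>count_space UNIV \<partial>count_space UNIV)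
      = of_nat (card ?O) * T * ennreal (x ^ i)"
      by (simp add: ac_simps)
  qed
  also have "\<dots> = of_nat (card ?O) * T * ennreal (1 / (1 - x))"
    using x by (simp only: ennreal_suminf_cmult suminf_geometric_ennreal)
  also have "\<dots> = ennreal (card ?O / (1 - x)) * T"
  proof -
    have "ennreal (card ?O / (1 - x)) = of_nat (card ?O) * ennreal (1 / (1 - x))"
      using x by (simp add: ennreal_of_nat_eq_real_of_nat ennreal_mult[symmetric])
    then show ?thesis by (simp add: ac_simps)
  qed
  finally show ?thesis unfolding x_def T_def .
qed

text \<open>For finite \<open>r\<close> the cost of the ancestors is a geometric series; for
  \<open>r = \<infinity>\<close> nothing is counted, and it suffices that the weights are at most
  \<open>1\<close>.\<close>

lemma morrey_norm_dyadic_maximal: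
  fixes p q t :: real
  assumes p: "1 < p" and q: "0 < q" and t: "0 < t" "ennreal t < r"
  shows "\<exists>C>0. \<forall>h :: real^'n \<Rightarrow> ennreal. h \<in> borel_measurable lebesgue \<longrightarrow>
    morrey_norm p q t r (dyadic_maximal h) \<le> ennreal C * morrey_norm p q t r h"
proof -
  obtain C where C: "0 < C" "\<And>(h :: real^'n \<Rightarrow> ennreal) t j k. h \<in> borel_measurable lebesgue \<Longrightarrow>
    morrey_term p q t (dyadic_maximal h) j k \<le> ennreal C *
      (SUP i. SUP e\<in>dyadic_offsets. ennreal (2 powr (- real i * real CARD('n) / t))
          * morrey_term p q t h (j - int i) (dyadic_parent i k + e))"
    using morrey_term_dyadic_maximal[OF p q] by blast
  show ?thesis
  proof (cases "r = \<infinity>")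
    case True
    have "morrey_norm p q t r (dyadic_maximal h) \<le> ennreal C * morrey_norm p q t r h"
      if [measurable]: "h \<in> borel_measurable lebesgue" for h :: "real^'n \<Rightarrow> ennreal"
    proof -
      have "morrey_term p q t (dyadic_maximal h) j k \<le> ennreal C * morrey_norm p q t r h" for j k
      proof (rule order_trans[OF C(2)[OF that]], intro mult_left_mono SUP_least)
        fix i and e :: "int^'n"
        have "2 powr (- real i * real CARD('n) / t) \<le> 2 powr 0"
          using t by (intro powr_mono) auto
        then have "ennreal (2 powr (- real i * real CARD('n) / t)) \<le> 1"
          by (simp add: ennreal_le_1)
        then have "ennreal (2 powr (- real i * real CARD('n) / t)) * morrey_term p q t h (j - int i) (dyadic_parent i k + e)
          \<le> 1 * morrey_norm p q t r h"
          using True by (intro mult_mono morrey_term_le_norm) auto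
        then show "ennreal (2 powr (- real i * real CARD('n) / t)) * morrey_term p q t h (j - int i) (dyadic_parent i k + e)
          \<le> morrey_norm p q t r h" by simp
      qed auto
      then show ?thesis
        using True by (auto simp: morrey_norm_def[of _ _ _ _ "dyadic_maximal h"] intro!: SUP_least)
    qed
    then show ?thesis using C(1) by blast
  next
    case False
    define s where "s = enn2real r"
    have rs: "r = ennreal s" using False by (simp add: s_def less_top)
    then have ts: "t < s" using t by (simp add: ennreal_less_iff)
    then have s: "0 < s" using t by simp
    define D where "D = card (dyadic_offsets :: (int^'n) set) / (1 - 2 powr (real CARD('n) * (1 - s / t)))"
    have "real CARD('n) * (1 - s / t) < 0" using t ts by (intro mult_pos_neg) auto
    then have "2 powr (real CARD('n) * (1 - s / t)) < 1"
      using powr_less_mono[of "real CARD('n) * (1 - s / t)" 0 "2::real"] by auto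
    then have D: "0 < D" by (simp add: D_def)
    have "morrey_norm p q t r (dyadic_maximal h) \<le> ennreal (C * D powr (1/s)) * morrey_norm p q t r h"
      if [measurable]: "h \<in> borel_measurable lebesgue" for h :: "real^'n \<Rightarrow> ennreal"
    proof -
      define T where "T = (\<integral>\<^sup>+j. \<integral>\<^sup>+k. ennreal_powr (morrey_term p q t h j k) s \<partial>count_space UNIV \<partial>count_space UNIV)"
      have "(\<integral>\<^sup>+j. \<integral>\<^sup>+k. ennreal_powr (morrey_term p q t (dyadic_maximal h) j k) s \<partial>count_space UNIV \<partial>count_space UNIV)
        \<le> (\<integral>\<^sup>+j. \<integral>\<^sup>+k. ennreal_powr (ennreal C) s * ennreal_powr (SUP i. SUP e\<in>dyadic_offsets. ennreal (2 powr (- real i * real CARD('n) / t))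
          * morrey_term p q t h (j - int i) (dyadic_parent i k + e)) s \<partial>count_space UNIV \<partial>count_space UNIV)"
        unfolding ennreal_powr_mult[OF s, symmetric]
        using s by (intro nn_integral_mono ennreal_powr_mono C(2)[OF that]) auto
      also have "\<dots> \<le> ennreal_powr (ennreal C) s * (ennreal D * T)"
        using nn_integral_SUP_ancestors_le[OF t(1) ts, of "morrey_term p q t h"] unfolding D_def T_def
        by (simp add: nn_integral_cmult mult_left_mono)
      finally have "morrey_norm p q t r (dyadic_maximal h) \<le> ennreal_powr (ennreal_powr (ennreal C) s * (ennreal D * T)) (1/s)"
        using s rs by (simp add: morrey_norm_def ennreal_powr_mono)
      also have "\<dots> = ennreal (C * D powr (1/s)) * morrey_norm p q t r h"
        using s rs C(1) D by (simp add: morrey_norm_def T_def ennreal_powr_mult ennreal_powr_powr powr_powr ennreal_mult mult.assoc)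
      finally show ?thesis .
    qed
    then show ?thesis
      using C(1) D by (intro exI[of _ "C * D powr (1/s)"]) auto
  qed
qed

section \<open>The power \<theta> relating the two sets of parameters\<close>

lemma lorentz_fun_powr:
  assumes "0 < \<theta>" "0 < p2" "p1 = \<theta> * p2" "q1 = \<theta> * q2"
  shows "lorentz_fun p2 q2 (\<lambda>u. ennreal_powr (\<phi> u) \<theta>) = lorentz_fun p1 q1 \<phi>"
proof -
  have "ennreal_powr (ennreal (u powr (1/p2)) * ennreal_powr (\<phi> u) \<theta>) q2 = ennreal_powr (ennreal (u powr (1/p1)) * \<phi> u) q1" for u
  proof -
    have "ennreal (u powr (1/p2)) = ennreal_powr (ennreal (u powr (1/p1))) \<theta>"
      using assms by (simp add: powr_powr)
    then show ?thesis
      by (simp only: ennreal_powr_mult[OF \<open>0 < \<theta>\<close>, symmetric] ennreal_powr_powr assms(4))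
  qed
  then show ?thesis by (simp add: lorentz_fun_def)
qed

text \<open>The reciprocals of \<open>p2\<close>, \<open>q2\<close>, \<open>t2\<close> are
  \<open>\<theta>\<close> times those of \<open>p1\<close>, \<open>q1\<close>, \<open>t1\<close>, so
  the volume weight, the Lorentz integral and its root all turn into \<open>\<theta>\<close>-th
  powers.\<close>

lemma morrey_term_powr_le:
  fixes g h :: "real^'n \<Rightarrow> ennreal"
  assumes \<theta>: "0 < \<theta>" and pq: "0 < p2" "0 < q2" and eq: "p1 = \<theta> * p2" "q1 = \<theta> * q2" "t1 = \<theta> * t2"
    and [measurable]: "g \<in> borel_measurable lebesgue" "h \<in> borel_measurable lebesgue"
    and le: "\<And>x. h x \<le> c * ennreal_powr (g x) \<theta>"
  shows "morrey_term p2 q2 t2 h j k \<le> c * ennreal_powr (morrey_term p1 q1 t1 g j k) \<theta>"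
proof -
  let ?Q = "dyadic_cube j k" and ?v = "dyadic_volume TYPE('n) j"
  let ?h = "\<lambda>x. h x * indicator ?Q x" and ?g = "\<lambda>x. g x * indicator ?Q x"
  have "rearr lebesgue ?h u \<le> c * ennreal_powr (rearr lebesgue ?g u) \<theta>" for u
    by (rule rearr_powr_le) (use \<theta> le in \<open>auto split: split_indicator\<close>)
  then have "lorentz_fun p2 q2 (rearr lebesgue ?h) \<le> lorentz_fun p2 q2 (\<lambda>u. c * ennreal_powr (rearr lebesgue ?g u) \<theta>)"
    by (intro lorentz_fun_mono pq)
  also have "\<dots> = ennreal_powr c q2 * lorentz_fun p1 q1 (rearr lebesgue ?g)"
    using pq \<theta> eq by (subst lorentz_fun_cmult) (auto simp: lorentz_fun_powr)
  finally have "ennreal_powr (lorentz_fun p2 q2 (rearr lebesgue ?h)) (1/q2)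
      \<le> ennreal_powr (ennreal_powr c q2 * lorentz_fun p1 q1 (rearr lebesgue ?g)) (1/q2)"
    using pq by (intro ennreal_powr_mono) auto
  also have "\<dots> = c * ennreal_powr (ennreal_powr (lorentz_fun p1 q1 (rearr lebesgue ?g)) (1/q1)) \<theta>"
    using pq \<theta> eq by (simp add: ennreal_powr_mult ennreal_powr_powr)
  finally have "morrey_term p2 q2 t2 h j k
      \<le> ennreal (?v powr (1/t2 - 1/p2)) * (c * ennreal_powr (ennreal_powr (lorentz_fun p1 q1 (rearr lebesgue ?g)) (1/q1)) \<theta>)"
    unfolding morrey_term_def by (rule mult_left_mono) simp
  also have "ennreal (?v powr (1/t2 - 1/p2)) = ennreal_powr (ennreal (?v powr (1/t1 - 1/p1))) \<theta>"
    using \<theta> eq by (simp add: powr_powr left_diff_distrib)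
  finally show ?thesis
    using \<theta> by (simp add: morrey_term_def ennreal_powr_mult mult.left_commute)
qed

text \<open>A finite Lorentz functional makes the rearrangement finite at each \<open>u > 0\<close>,
  so inside a unit cube the infinite values occupy measure at most \<open>u\<close>, for all
  \<open>u\<close>. Through Hedberg's inequality this gives absolute convergence of the potential
  almost everywhere.\<close>

lemma AE_finite_of_morrey_term:
  fixes g :: "real^'n \<Rightarrow> ennreal"
  assumes pq: "0 < p" "0 < q" and [measurable]: "g \<in> borel_measurable lebesgue"
    and fin: "\<And>j k. morrey_term p q t g j k < top"
  shows "AE x in lebesgue. g x < top"
proof -
  have "AE x in lebesgue. g x * indicator (dyadic_cube 0 k) x \<noteq> top" for k :: "int^'n"
  proof -
    let ?g = "\<lambda>x. g x * indicator (dyadic_cube 0 k) x"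
    have "lorentz_fun p q (rearr lebesgue ?g) < top"
      unfolding lorentz_fun_morrey_term[OF pq(2), of p g 0 k t]
      using fin[of 0 k] by (auto simp: less_top[symmetric] ennreal_mult_eq_top_iff)
    then have R: "rearr lebesgue ?g u < top" if "0 < u" for u
      using antimono_le_lorentz_fun[OF pq that rearr_antimono, of lebesgue ?g]
      by (auto simp: less_top[symmetric] top_unique ennreal_mult_eq_top_iff)
    have "emeasure lebesgue {x \<in> space lebesgue. ?g x = top} \<le> 0 + ennreal u" if "0 < u" for u
    proof -
      have "emeasure lebesgue {x \<in> space lebesgue. ?g x = top} \<le> emeasure lebesgue {x \<in> space lebesgue. rearr lebesgue ?g u < ?g x}"
      proof (rule emeasure_mono)
        show "{x \<in> space lebesgue. ?g x = top} \<subseteq> {x \<in> space lebesgue. rearr lebesgue ?g u < ?g x}"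
          using R[OF that] by auto
      qed measurable
      also have "\<dots> \<le> ennreal u" by (rule emeasure_gt_rearr) simp
      finally show ?thesis by simp
    qed
    then have "emeasure lebesgue {x \<in> space lebesgue. ?g x = top} \<le> 0"
      by (rule ennreal_le_epsilon)
    then show ?thesis
    proof (intro AE_I[where N = "{x \<in> space lebesgue. ?g x = top}"])
      show "{x \<in> space lebesgue. ?g x = top} \<in> sets lebesgue" by measurable
    qed auto
  qed
  then have "AE x in lebesgue. \<forall>k :: int^'n. g x * indicator (dyadic_cube 0 k) x \<noteq> top"
    by (simp add: AE_all_countable)
  then show ?thesis
  proof eventually_elim
    case (elim x)
    then have "g x * indicator (dyadic_cube 0 (dyadic_index 0 x)) x \<noteq> top" by blast
    then show ?case by (simp add: mem_dyadic_cube less_top)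
  qed
qed

section \<open>Measurability of the fractional integral\<close>

lemma lebesgue_ex_borel_complex:
  fixes f :: "'a :: euclidean_space \<Rightarrow> complex"
  assumes "f \<in> borel_measurable lebesgue"
  shows "\<exists>g\<in>borel_measurable borel. AE x in lebesgue. f x = g x"
proof -
  have "(\<lambda>x. Re (f x)) \<in> borel_measurable lebesgue" "(\<lambda>x. Im (f x)) \<in> borel_measurable lebesgue"
    using assms by (auto intro: borel_measurable_Re borel_measurable_Im)
  then obtain g1 g2 where g: "g1 \<in> borel_measurable lborel" "AE x in lborel. Re (f x) = g1 x"
    "g2 \<in> borel_measurable lborel" "AE x in lborel. Im (f x) = g2 x"
    by (blast dest: completion_ex_borel_measurable_real)
  then have "AE x in lborel. f x = Complex (g1 x) (g2 x)"
    by (auto simp: complex_eq_iff)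
  moreover have "(\<lambda>x. Complex (g1 x) (g2 x)) \<in> borel_measurable borel"
    using g(1,3) by (simp add: Complex_eq)
  ultimately show ?thesis
    by (intro bexI[of _ "\<lambda>x. Complex (g1 x) (g2 x)"] AE_completion)
qed

lemma measurable_fractional_integrand [measurable]:
  fixes f :: "real^'n \<Rightarrow> complex"
  assumes "f \<in> borel_measurable lebesgue"
  shows "fractional_integrand \<alpha> f x \<in> borel_measurable lebesgue"
proof -
  have "(\<lambda>y. complex_of_real (norm (x - y) powr (real CARD('n) - \<alpha>))) \<in> borel_measurable lebesgue"
    by (intro measurable_completion) measurable
  then show ?thesis
    unfolding fractional_integrand_def[abs_def] using assms by (intro borel_measurable_divide)
qed

text \<open>A parameter integral is measurable when its integrand is jointly measurable, which a
  Borel representative \<open>g\<close> of \<open>f\<close> provides. For each \<open>x\<close> the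
  replacement changes the integrand only on a null set of \<open>y\<close>, so the integral is the
  same at every \<open>x\<close>.\<close>

lemma measurable_fractional_integral:
  fixes f :: "real^'n \<Rightarrow> complex"
  assumes f: "f \<in> borel_measurable lebesgue"
  shows "fractional_integral \<alpha> f \<in> borel_measurable lebesgue"
proof -
  obtain g where [measurable]: "g \<in> borel_measurable borel" and g: "AE x in lebesgue. f x = g x"
    using lebesgue_ex_borel_complex[OF f] by blast
  have [measurable]: "(\<lambda>(x, y). fractional_integrand \<alpha> g x y) \<in> borel_measurable (borel \<Otimes>\<^sub>M lborel)"
    unfolding fractional_integrand_def[abs_def] by measurable
  have "fractional_integral \<alpha> f x = (LINT y|lborel. fractional_integrand \<alpha> g x y)" for x
  proof -
    have m: "fractional_integrand \<alpha> g x \<in> borel_measurable lborel"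
      unfolding fractional_integrand_def[abs_def] by measurable
    have "fractional_integral \<alpha> f x = (LINT y|lebesgue. fractional_integrand \<alpha> g x y)"
      unfolding fractional_integral_def
    proof (rule integral_cong_AE)
      show "AE y in lebesgue. fractional_integrand \<alpha> f x y = fractional_integrand \<alpha> g x y"
        using g by eventually_elim (simp add: fractional_integrand_def)
    qed (use f m in \<open>auto intro: measurable_fractional_integrand measurable_completion\<close>)
    also have "\<dots> = (LINT y|lborel. fractional_integrand \<alpha> g x y)"
      by (rule integral_completion[OF m])
    finally show ?thesis .
  qed
  then have "fractional_integral \<alpha> f = (\<lambda>x. LINT y|lborel. fractional_integrand \<alpha> g x y)"
    by (rule ext)
  moreover have "(\<lambda>x. LINT y|lborel. fractional_integrand \<alpha> g x y) \<in> borel_measurable borel"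
    by (rule lborel.borel_measurable_lebesgue_integral) measurable
  ultimately show ?thesis
    by (auto intro: measurable_completion)
qed

lemma nn_integral_norm_fractional_integrand:
  fixes f :: "real^'n \<Rightarrow> complex"
  shows "(\<integral>\<^sup>+y. ennreal (norm (fractional_integrand \<alpha> f x y)) \<partial>lebesgue) = riesz_potential \<alpha> (\<lambda>y. ennreal (norm (f y))) x"
  unfolding riesz_potential_def fractional_integrand_def
  by (intro nn_integral_cong) (simp add: norm_divide ennreal_mult[symmetric])

text \<open>Where the integrand is not integrable, the Bochner integral is \<open>0\<close> by
  convention and the bound is trivial; hence no exceptional set is needed.\<close>

lemma norm_fractional_integral_le:
  fixes f :: "real^'n \<Rightarrow> complex"
  shows "ennreal (norm (fractional_integral \<alpha> f x)) \<le> riesz_potential \<alpha> (\<lambda>y. ennreal (norm (f y))) x"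
proof (cases "integrable lebesgue (fractional_integrand \<alpha> f x)")
  case True
  then show ?thesis
    unfolding fractional_integral_def nn_integral_norm_fractional_integrand[symmetric]
    by (rule integral_norm_bound_ennreal)
qed (simp add: fractional_integral_def not_integrable_integral_eq)

section \<open>Hedberg's inequality combined with the bound for the maximal operator\<close>

theorem theorem4p12:
  fixes \<alpha> p1 p2 q1 q2 t1 t2 :: real and r1 r2 :: ennreal
  assumes "1 < q1" "1 < q2"
    and "0 < \<alpha>" "\<alpha> < real CARD('n::finite)"
    and "1 < t1" "1 < t2"
    and "1/t2 = 1/t1 - \<alpha> / real CARD('n)"
    and "(1 < p1 \<and> p1 < t1 \<and> ennreal t1 < r1 \<and> r1 < \<infinity> \<and>
          1 < p2 \<and> p2 < t2 \<and> ennreal t2 < r2 \<and> r2 < \<infinity> \<and>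
          p1/p2 = q1/q2 \<and> q1/q2 = t1/t2 \<and> ennreal (t1/t2) = r1/r2)
       \<or> (1 < p1 \<and> p1 \<le> t1 \<and> r1 = \<infinity> \<and>
          1 < p2 \<and> p2 \<le> t2 \<and> r2 = \<infinity> \<and>
          p1/p2 = q1/q2 \<and> q1/q2 = t1/t2)"
  shows "\<exists>C>0. \<forall>f \<in> (bourgain_morrey_lorentz_space p1 q1 t1 r1 :: (real^'n \<Rightarrow> complex) set).
           (AE x in lebesgue. fractional_integrable_at \<alpha> f x) \<and>
           fractional_integral \<alpha> f \<in> bourgain_morrey_lorentz_space p2 q2 t2 r2 \<and>
           bourgain_morrey_lorentz_norm p2 q2 t2 r2 (fractional_integral \<alpha> f)
             \<le> ennreal C * bourgain_morrey_lorentz_norm p1 q1 t1 r1 f"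
proof -
  let ?n = "real CARD('n)"
  define \<theta> where "\<theta> = t1 / t2"
  have pos: "0 < q1" "0 < q2" "0 < t1" "0 < t2" "1 < p1" "1 < p2" "0 < p2"
    using assms by auto
  have \<theta>: "0 < \<theta>" using pos by (simp add: \<theta>_def)
  have eq: "p1 = \<theta> * p2" "q1 = \<theta> * q2" "t1 = \<theta> * t2"
  proof -
    have "p1 / p2 = \<theta>" "q1 / q2 = \<theta>" using assms(8) by (auto simp: \<theta>_def)
    then show "p1 = \<theta> * p2" "q1 = \<theta> * q2"
      using pos by (auto simp: divide_eq_eq)
    show "t1 = \<theta> * t2"
      using pos by (simp add: \<theta>_def)
  qed
  have t1r1: "ennreal t1 < r1" using assms(8) by auto
  have r: "r1 = \<infinity> \<and> r2 = \<infinity> \<or> r1 \<noteq> \<infinity> \<and> r2 \<noteq> \<infinity> \<and> 0 < enn2real r2 \<and> enn2real r1 = \<theta> * enn2real r2"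
  proof (cases "r1 = \<infinity>")
    case False
    then have R: "ennreal t1 < r1" "r1 < \<infinity>" "ennreal t2 < r2" "r2 < \<infinity>" "ennreal \<theta> = r1 / r2"
      using assms(8) by (auto simp: \<theta>_def)
    then obtain s1 s2 where s: "r1 = ennreal s1" "0 \<le> s1" "r2 = ennreal s2" "0 \<le> s2"
      by (cases r1; cases r2) auto
    then have "t1 < s1" "t2 < s2" using R pos by (auto simp: ennreal_less_iff)
    then show ?thesis using R s pos \<theta> by (simp add: divide_ennreal)
  qed (use assms(8) in auto)
  then have r1: "r1 = \<infinity> \<or> 0 < enn2real r1" and r2: "r2 = \<infinity> \<or> 0 < enn2real r2"
    using \<theta> by auto
  \<comment> \<open>With this choice \<open>\<alpha> + \<gamma>\<close> is \<open>n / t1\<close>,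
    the growth exponent of averages in the source space, and the exponents in Hedberg's inequality
    become \<open>1 - \<theta>\<close> and \<open>\<theta>\<close>.\<close>
  define \<gamma> where "\<gamma> = ?n / t2"
  have \<gamma>: "0 < \<gamma>" using pos by (simp add: \<gamma>_def)
  have \<alpha>\<gamma>: "\<alpha> + \<gamma> = ?n / t1"
    using assms(7) pos unfolding \<gamma>_def by (simp add: field_simps)
  have \<gamma>\<theta>: "\<gamma> / (\<alpha> + \<gamma>) = \<theta>"
    unfolding \<alpha>\<gamma> using pos by (simp add: \<gamma>_def \<theta>_def)
  have \<alpha>\<theta>: "\<alpha> / (\<alpha> + \<gamma>) = 1 - \<theta>"
    unfolding \<gamma>\<theta>[symmetric] using assms(3) \<gamma> by (simp add: field_simps)
  have "0 < 1 - \<theta>" unfolding \<alpha>\<theta>[symmetric] using assms(3) \<gamma> by simp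
  obtain C1 where C1: "0 < C1" "\<And>(h :: real^'n \<Rightarrow> ennreal) t j k. h \<in> borel_measurable lebesgue \<Longrightarrow>
    dyadic_avg h j k \<le> ennreal (C1 * dyadic_volume TYPE('n) j powr (- 1/t)) * morrey_term p1 q1 t h j k"
    using dyadic_avg_le_morrey_term[of p1 q1] pos by blast
  obtain C2 where C2: "0 < C2" "\<And>h :: real^'n \<Rightarrow> ennreal. h \<in> borel_measurable lebesgue \<Longrightarrow>
    morrey_norm p1 q1 t1 r1 (dyadic_maximal h) \<le> ennreal C2 * morrey_norm p1 q1 t1 r1 h"
    using morrey_norm_dyadic_maximal[of p1 q1 t1 r1] pos t1r1 by blast
  obtain C3 where C3: "0 < C3" "\<And>(h :: real^'n \<Rightarrow> ennreal) N x. h \<in> borel_measurable lebesgue \<Longrightarrow> N < top \<Longrightarrow>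
    (\<And>j k. dyadic_avg h j k \<le> ennreal (2 powr (of_int j * (\<alpha> + \<gamma>))) * N) \<Longrightarrow>
    riesz_potential \<alpha> h x \<le> ennreal C3 * ennreal_powr N (1 - \<theta>) * ennreal_powr (dyadic_maximal h x) \<theta>"
    using riesz_potential_hedberg[OF assms(3,4) \<gamma>] unfolding \<gamma>\<theta> \<alpha>\<theta> by metis
  \<comment> \<open>\<open>C1\<close> bounds averages by the norm and enters with the exponent of
    the norm in Hedberg's inequality; \<open>C2\<close> bounds the maximal operator and enters with
    the exponent of the maximal function.\<close>
  define C where "C = C3 * C1 powr (1 - \<theta>) * C2 powr \<theta>"
  have "0 < C" using C1(1) C2(1) C3(1) by (simp add: C_def)
  have main: "(AE x in lebesgue. fractional_integrable_at \<alpha> f x) \<and>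
           fractional_integral \<alpha> f \<in> bourgain_morrey_lorentz_space p2 q2 t2 r2 \<and>
           bourgain_morrey_lorentz_norm p2 q2 t2 r2 (fractional_integral \<alpha> f)
             \<le> ennreal C * bourgain_morrey_lorentz_norm p1 q1 t1 r1 f"
    if "f \<in> bourgain_morrey_lorentz_space p1 q1 t1 r1" for f :: "real^'n \<Rightarrow> complex"
  proof -
    define h where "h x = ennreal (norm (f x))" for x
    define N where "N = morrey_norm p1 q1 t1 r1 h"
    have N: "bourgain_morrey_lorentz_norm p1 q1 t1 r1 f = N"
      unfolding N_def h_def[abs_def] by (rule bourgain_morrey_lorentz_norm_eq[OF r1])
    have f [measurable]: "f \<in> borel_measurable lebesgue" and "N < top"
      using that by (auto simp: bourgain_morrey_lorentz_space_def N[symmetric])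
    have h [measurable]: "h \<in> borel_measurable lebesgue"
      unfolding h_def[abs_def] by measurable
    \<comment> \<open>\<open>ennreal C1 * N\<close> is the growth constant of the averages of
      \<open>h\<close>; Hedberg's inequality thus holds with a factor that does not depend on
      \<open>x\<close>.\<close>
    define c where "c = ennreal C3 * ennreal_powr (ennreal C1 * N) (1 - \<theta>)"
    have "c < top"
      using \<open>N < top\<close> by (auto simp: c_def less_top[symmetric] ennreal_mult_eq_top_iff)
    have hedberg: "riesz_potential \<alpha> h x \<le> c * ennreal_powr (dyadic_maximal h x) \<theta>" for x
      unfolding c_def
    proof (rule C3(2)[OF h])
      show "ennreal C1 * N < top"
        using \<open>N < top\<close> by (auto simp: less_top[symmetric] ennreal_mult_eq_top_iff)
      fix j and k :: "int^'n"
      have "dyadic_volume TYPE('n) j powr (- 1/t1) = 2 powr (of_int j * (\<alpha> + \<gamma>))"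
        unfolding dyadic_volume_def powr_powr \<alpha>\<gamma> by simp
      then have "dyadic_avg h j k \<le> ennreal (C1 * 2 powr (of_int j * (\<alpha> + \<gamma>))) * N"
        using order_trans[OF C1(2)[OF h, of j k t1] mult_left_mono[OF morrey_term_le_norm[OF r1]]]
        by (simp add: N_def)
      then show "dyadic_avg h j k \<le> ennreal (2 powr (of_int j * (\<alpha> + \<gamma>))) * (ennreal C1 * N)"
        using C1(1) by (simp add: ennreal_mult ac_simps)
    qed
    have CN: "morrey_norm p1 q1 t1 r1 (dyadic_maximal h) \<le> ennreal C2 * N"
      unfolding N_def by (rule C2(2)) fact
    have fin: "morrey_term p1 q1 t1 (dyadic_maximal h) j k < top" for j k
    proof -
      have "morrey_term p1 q1 t1 (dyadic_maximal h) j k \<le> ennreal C2 * N"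
        using CN by (rule order_trans[OF morrey_term_le_norm[OF r1]])
      also have "\<dots> < top" using \<open>N < top\<close> by (auto simp: less_top[symmetric] ennreal_mult_eq_top_iff)
      finally show ?thesis .
    qed
    have "AE x in lebesgue. dyadic_maximal h x < top"
      by (rule AE_finite_of_morrey_term[of p1 q1 _ t1]) (use fin pos in auto)
    then have AE: "AE x in lebesgue. fractional_integrable_at \<alpha> f x"
    proof eventually_elim
      case (elim x)
      have "riesz_potential \<alpha> h x < top"
        by (rule le_less_trans[OF hedberg]) (use elim \<open>c < top\<close> in \<open>auto simp: less_top[symmetric] ennreal_mult_eq_top_iff\<close>)
      then show ?case
        unfolding fractional_integrable_at_def
        by (intro integrableI_bounded measurable_fractional_integrand f)
           (simp add: nn_integral_norm_fractional_integrand h_def[abs_def])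
    qed
    define H where "H x = ennreal (norm (fractional_integral \<alpha> f x))" for x
    have I [measurable]: "fractional_integral \<alpha> f \<in> borel_measurable lebesgue"
      by (rule measurable_fractional_integral) fact
    then have [measurable]: "H \<in> borel_measurable lebesgue"
      unfolding H_def[abs_def] by measurable
    have H: "H x \<le> c * ennreal_powr (dyadic_maximal h x) \<theta>" for x
      using norm_fractional_integral_le[of \<alpha> f x] hedberg[of x] unfolding H_def h_def[abs_def] by (rule order_trans)
    have "bourgain_morrey_lorentz_norm p2 q2 t2 r2 (fractional_integral \<alpha> f) = morrey_norm p2 q2 t2 r2 H"
      unfolding H_def[abs_def] by (rule bourgain_morrey_lorentz_norm_eq[OF r2])
    also have "\<dots> \<le> c * ennreal_powr (morrey_norm p1 q1 t1 r1 (dyadic_maximal h)) \<theta>"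
      by (intro morrey_norm_powr_le \<theta> r morrey_term_powr_le eq pos H) auto
    also have "\<dots> \<le> c * ennreal_powr (ennreal C2 * N) \<theta>"
      using \<theta> by (intro mult_left_mono ennreal_powr_mono CN) auto
    also have "\<dots> = ennreal C3 * (ennreal (C1 powr (1 - \<theta>)) * ennreal_powr N (1 - \<theta>)) * (ennreal (C2 powr \<theta>) * ennreal_powr N \<theta>)"
      using C1(1) C2(1) \<theta> \<open>0 < 1 - \<theta>\<close> by (simp add: c_def ennreal_powr_mult)
    also have "\<dots> = ennreal C * (ennreal_powr N (1 - \<theta>) * ennreal_powr N \<theta>)"
      using C3(1) by (simp add: C_def ennreal_mult ac_simps)
    \<comment> \<open>The exponents add up to \<open>1\<close>, which restores homogeneity of degree
      one in \<open>f\<close>.\<close>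
    also have "ennreal_powr N (1 - \<theta>) * ennreal_powr N \<theta> = N"
      using \<open>N < top\<close> by (cases N) (auto simp: ennreal_mult[symmetric] powr_add[symmetric])
    finally have bound: "bourgain_morrey_lorentz_norm p2 q2 t2 r2 (fractional_integral \<alpha> f) \<le> ennreal C * N" .
    also have "ennreal C * N < top"
      using \<open>N < top\<close> by (auto simp: less_top[symmetric] ennreal_mult_eq_top_iff)
    finally show ?thesis
      using AE I bound by (simp add: bourgain_morrey_lorentz_space_def N)
  qed
  then show ?thesis
    using \<open>0 < C\<close> by blast
qed

end
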